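(* Let $n\ge2$ and $f\in\mathcal S_r(\mathbb R^{n-1}\times\mathbb R^{n-1})$. Then $Cf(\mathbf u,\mathbf v)=0$ for all $(\mathbf u,\mathbf v)\in\mathbb R^{n-1}\times\mathbb R^{n-1}$ with $|\mathbf u|>\sqrt{1+|\mathbf v|^2}$ if and only if $f(\mathbf x,\mathbf y)=0$ for all $(\mathbf x,\mathbf y)$ with $|\mathbf x|^2+|\mathbf y|^2>1$. Also, for $\mathbf f(\mathbf x,|\mathbf y|)=f(\mathbf x,\mathbf y)$: $\mathcal C\mathbf f(\mathbf u,s)=0$ for all $(\mathbf u,s)\in\mathbb R^{n-1}\times[0,\infty)$ with $|\mathbf u|>\sqrt{1+s^2}$ if and only if $\mathbf f(\mathbf x,z)=0$ for all $(\mathbf x,z)\in\mathbb R^{n-1}\times[0,\infty)$ with $|\mathbf x|^2+z^2>1$.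
   Context: $\mathcal S_r(\mathbb R^{n-1}\times\mathbb R^{n-1})$ is the set of Schwartz functions $f\in\mathcal S(\mathbb R^{2(n-1)})$ with $f(\mathbf x,\mathbf y)=f(\mathbf x,U\mathbf y)$ for all $(\mathbf x,\mathbf y)$ and all orthogonal transformations $U$ of $\mathbb R^{n-1}$. The cone transform is $Cf(\mathbf u,\mathbf v)=\int_{\mathbb R^{n-1}}f(\mathbf u+|\mathbf v|\mathbf y,\mathbf y)\,d\mathbf y$. For $\mathbf f$ on $\mathbb R^{n-1}\times[0,\infty)$, $$\mathcal C\mathbf f(\mathbf u,s)=\int_{S^{n-2}}\int_0^\infty\mathbf f(\mathbf u+zs\boldsymbol\theta,z)z^{n-2}\,dz\,dS(\boldsymbol\theta)\ (n\ge3),\qquad \mathcal C\mathbf f(u,s)=\int_0^\infty\big(\mathbf f(u+zs,z)+\mathbf f(u-zs,z)\big)dz\ (n=2),$$ where $dS$ is the standard measure on the unit sphere $S^{n-2}$. *)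

theory Defs
  imports "HOL-Analysis.Analysis"
begin

primrec iter_partial :: "'a::euclidean_space list \<Rightarrow> ('a \<Rightarrow> 'b::real_normed_vector) \<Rightarrow> 'a \<Rightarrow> 'b" where
  "iter_partial [] f = f"
| "iter_partial (b # bs) f = (\<lambda>x. frechet_derivative (iter_partial bs f) (at x) b)"

(* All iterated partial derivatives exist and are Frechet differentiable at every point
   (that is, f is C-infinity), and each of them decays faster than any power of the norm. *)
definition schwartz :: "('a::euclidean_space \<Rightarrow> 'b::real_normed_vector) \<Rightarrow> bool" where
  "schwartz f \<longleftrightarrow>
     (\<forall>bs. set bs \<subseteq> Basis \<longrightarrow>
        (\<forall>x. iter_partial bs f differentiable (at x)) \<and>
        (\<forall>k::nat. bounded (range (\<lambda>x. norm x ^ k *\<^sub>R iter_partial bs f x))))"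

definition schwartz_radial :: "((real ^ 'm) \<times> (real ^ 'm) \<Rightarrow> complex) set" where
  "schwartz_radial =
     {f. schwartz f \<and> (\<forall>U. orthogonal_transformation U \<longrightarrow> (\<forall>x y. f (x, y) = f (x, U y)))}"

definition cone_transform ::
    "((real ^ 'm) \<times> (real ^ 'm) \<Rightarrow> complex) \<Rightarrow> real ^ 'm \<Rightarrow> real ^ 'm \<Rightarrow> complex" where
  "cone_transform f u v = (LINT y|lborel. f (u + norm v *\<^sub>R y, y))"

(* Surface measure of the unit sphere of R^m, as the measure sigma of the polar coordinate formula
   dx = r^(m-1) dr dsigma: sigma(A) is m times the Lebesgue measure of the part
   {r t. 0 < r <= 1, t in A} of the unit ball lying over A. *)
definition unit_sphere_measure :: "(real ^ 'm) measure" where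
  "unit_sphere_measure =
     scale_measure (of_nat CARD('m))
       (distr (restrict_space lborel (cball 0 1 - {0})) (restrict_space borel (sphere 0 1)) sgn)"

(* The ambient space R^(n-1) has n - 1 = CARD('m), so the weight z^(n-2) is z^(CARD('m) - 1).
   If CARD('m) = 1 then vec is the identification of the reals with R^1. *)
definition reduced_cone_transform ::
    "((real ^ 'm) \<times> real \<Rightarrow> complex) \<Rightarrow> real ^ 'm \<Rightarrow> real \<Rightarrow> complex" where
  "reduced_cone_transform g u s =
     (if CARD('m) = 1
      then (LINT z:{0..}|lborel. g (u + vec (z * s), z) + g (u - vec (z * s), z))
      else (LINT \<theta>|unit_sphere_measure.
              (LINT z:{0..}|lborel. z ^ (CARD('m) - 1) *\<^sub>R g (u + (z * s) *\<^sub>R \<theta>, z))))"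

end

theory Submission
  imports Defs
begin

text \<open>Because \<open>f\<close> is radial in \<open>y\<close>, integrating \<open>Cf\<close> over hyperplanes in \<open>u\<close> gives the integrals of
  \<open>f\<close> over all hyperplanes of \<open>R\<^sup>2\<^sup>m\<close>, \<open>m = n - 1\<close>, with normal \<open>(a, b)\<close>, \<open>a \<noteq> 0\<close>. The vanishing of
  \<open>Cf\<close> says that these integrals are zero whenever the hyperplane misses the closed unit ball, and
  what remains is Helgason's support theorem. Differentiating in the normal shows that \<open>f q\<close> has the
  same property for every polynomial \<open>q\<close>. A superposition over normals, whose kernel is the volume of
  a solid cone and hence radial, turns this into
  \<open>\<integral> f q |x|\<^sup>-\<^sup>2\<^sup>m\<^sup>-\<^sup>1 (|x|\<^sup>2 - s\<^sup>2)\<^sub>+\<^sup>m dx = 0\<close> for \<open>s > 1\<close>. After \<open>m\<close> derivatives in \<open>s\<^sup>2\<close>, \<open>f q\<close>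
  integrates to zero over annuli with weight \<open>|x|\<^sup>-\<^sup>2\<^sup>m\<^sup>-\<^sup>1\<close>, and polynomials are dense on the compact
  annulus. The reduced transform equals \<open>Cf\<close> by polar coordinates.\<close>

section \<open>Invariance of Lebesgue measure\<close>

text \<open>Without the multipliers \<open>q\<close>, integrating over all normals keeps only the
  spherical means of \<open>f\<close>; letting \<open>q\<close> run through all polynomials recovers
  \<open>f\<close> itself. This costs moments of every order, and that is where rapid decay enters:
  Helgason's theorem is false for functions with only a fixed polynomial rate of decay. Hyperplane
  integrals never appear as such. They are replaced by integrals against the truncated powers of
  \<open>x \<bullet> \<xi> - c\<close> over half spaces. All exponents are carried along at once,
  because a derivative in \<open>\<xi>\<close> in direction \<open>w\<close> lowers the exponent by
  one and produces exactly the factor \<open>x \<bullet> w\<close>. Normals with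
  \<open>a = 0\<close> are not reached by the cone transform. They form a null set, which an
  integral over normals ignores, while the remaining set \<open>\<Omega>\<close> is open, which the
  derivatives in the normal require. The converse implications are pointwise: outside the critical
  region the planes of integration miss the closed unit ball.\<close>

lemma lborel_distr_translate:
  "distr lborel borel (\<lambda>x. t + x) = (lborel :: 'a::euclidean_space measure)"
  using lborel_affine[of 1 t] by (simp add: density_1)

lemma nn_integral_lborel_translate:
  fixes f :: "'a::euclidean_space \<Rightarrow> ennreal"
  assumes [measurable]: "f \<in> borel_measurable borel"
  shows "(\<integral>\<^sup>+x. f (t + x) \<partial>lborel) = (\<integral>\<^sup>+x. f x \<partial>lborel)"
proof -
  have "(\<integral>\<^sup>+x. f x \<partial>distr lborel borel (\<lambda>x. t + x)) = (\<integral>\<^sup>+x. f (t + x) \<partial>lborel)"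
    by (rule nn_integral_distr) auto
  then show ?thesis by (simp add: lborel_distr_translate)
qed

text \<open>The two sides of the computation count
  \<open>{(x, y). x \<in> cball 0 1 \<and> x + y \<in> E}\<close> in both orders of integration.\<close>
lemma translation_invariant_eq_lborel:
  fixes \<mu> :: "'a::euclidean_space measure"
  assumes sets: "sets \<mu> = sets borel" and sf: "sigma_finite_measure \<mu>"
    and trans: "\<And>t. distr \<mu> borel (\<lambda>x. t + x) = \<mu>"
    and ball: "\<And>c. emeasure \<mu> (cball c 1) = emeasure lborel (cball c 1)"
  shows "\<mu> = lborel"
proof (rule measure_eqI)
  show "sets \<mu> = sets lborel" using sets by simp
next
  fix E assume "E \<in> sets \<mu>"
  then have [measurable]: "E \<in> sets borel" using sets by simp
  have smu [measurable_cong]: "sets \<mu> = sets borel" by (rule sets)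
  interpret M: sigma_finite_measure \<mu> by (rule sf)
  interpret P: pair_sigma_finite lborel \<mu> ..
  define B where "B = cball (0::'a) 1"
  have [measurable]: "B \<in> sets borel" by (simp add: B_def)
  have [measurable]: "(\<lambda>p. indicator B (fst p) * indicator E (fst p + snd p) :: ennreal)
        \<in> borel_measurable (lborel \<Otimes>\<^sub>M \<mu>)"
      "(\<lambda>p. indicator B (fst p - snd p) * indicator E (fst p) :: ennreal)
        \<in> borel_measurable (lborel \<Otimes>\<^sub>M \<mu>)"
    by (subst measurable_cong_sets[OF sets_pair_measure_cong[OF sets_lborel smu] refl], measurable)+
  have tr: "(\<integral>\<^sup>+y. f (t + y) \<partial>\<mu>) = (\<integral>\<^sup>+y. f y \<partial>\<mu>)"
    if [measurable]: "f \<in> borel_measurable borel" for f t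
  proof -
    have "(\<integral>\<^sup>+x. f x \<partial>distr \<mu> borel (\<lambda>x. t + x)) = (\<integral>\<^sup>+x. f (t + x) \<partial>\<mu>)"
      by (rule nn_integral_distr) auto
    then show ?thesis by (simp add: trans)
  qed
  have "emeasure lborel B * emeasure \<mu> E
      = (\<integral>\<^sup>+x. indicator B x * (\<integral>\<^sup>+y. indicator E (x + y) \<partial>\<mu>) \<partial>lborel)"
    by (subst tr) (simp_all add: nn_integral_multc sets)
  also have "\<dots> = (\<integral>\<^sup>+x. (\<integral>\<^sup>+y. indicator B x * indicator E (x + y) \<partial>\<mu>) \<partial>lborel)"
    by (intro nn_integral_cong nn_integral_cmult[symmetric]) auto
  also have "\<dots> = (\<integral>\<^sup>+y. (\<integral>\<^sup>+x. indicator B x * indicator E (x + y) \<partial>lborel) \<partial>\<mu>)"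
    using P.Fubini'[of "\<lambda>x y. indicator B x * indicator E (x + y)"]
    by (simp add: case_prod_beta)
  also have "\<dots> = (\<integral>\<^sup>+y. (\<integral>\<^sup>+x. indicator B (x - y) * indicator E x \<partial>lborel) \<partial>\<mu>)"
  proof (rule nn_integral_cong)
    fix y
    show "(\<integral>\<^sup>+x. indicator B x * indicator E (x + y) \<partial>lborel)
        = (\<integral>\<^sup>+x. indicator B (x - y) * indicator E x \<partial>lborel)"
      using nn_integral_lborel_translate[of "\<lambda>x. indicator B (x - y) * indicator E x" y]
      by (simp add: add.commute)
  qed
  also have "\<dots> = (\<integral>\<^sup>+x. (\<integral>\<^sup>+y. indicator B (x - y) * indicator E x \<partial>\<mu>) \<partial>lborel)"
    using P.Fubini'[of "\<lambda>x y. indicator B (x - y) * indicator E x"]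
    by (simp add: case_prod_beta)
  also have "\<dots> = (\<integral>\<^sup>+x. emeasure \<mu> (cball x 1) * indicator E x \<partial>lborel)"
  proof (rule nn_integral_cong)
    fix x
    have "(\<integral>\<^sup>+y. indicator B (x - y) * indicator E x \<partial>\<mu>)
        = (\<integral>\<^sup>+y. indicator (cball x 1) y * indicator E x \<partial>\<mu>)"
      by (intro nn_integral_cong) (auto simp: B_def indicator_def dist_norm norm_minus_commute)
    also have "\<dots> = (\<integral>\<^sup>+y. indicator (cball x 1) y \<partial>\<mu>) * indicator E x"
      by (rule nn_integral_multc, rule borel_measurable_indicator) (simp add: sets)
    also have "(\<integral>\<^sup>+y. indicator (cball x 1) y \<partial>\<mu>) = emeasure \<mu> (cball x 1)"
      by (rule nn_integral_indicator) (simp add: sets)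
    finally show "(\<integral>\<^sup>+y. indicator B (x - y) * indicator E x \<partial>\<mu>)
        = emeasure \<mu> (cball x 1) * indicator E x" .
  qed
  also have "\<dots> = (\<integral>\<^sup>+x. emeasure lborel B * indicator E x \<partial>lborel)"
    by (simp add: B_def ball emeasure_cball)
  also have "\<dots> = emeasure lborel B * emeasure lborel E"
    by (simp add: nn_integral_cmult)
  finally show "emeasure \<mu> E = emeasure lborel E"
    using unit_ball_vol_pos[of "real DIM('a)"] less_imp_neq
    by (fastforce simp add: B_def emeasure_cball ennreal_mult_cancel_left)
qed

text \<open>Preimages of unit balls under \<open>U\<close> are unit balls, and translating after
  \<open>U\<close> is the same as applying \<open>U\<close> after another translation. The image
  measure therefore meets the criterion above.\<close>

lemma lborel_distr_orthogonal:
  fixes U :: "'a::euclidean_space \<Rightarrow> 'a"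
  assumes U: "orthogonal_transformation U"
  shows "distr lborel borel U = lborel"
proof -
  have lin: "linear U" using U by (simp add: orthogonal_transformation_def)
  then have [measurable]: "U \<in> borel_measurable borel"
    by (simp add: linear_continuous_on linear_conv_bounded_linear borel_measurable_continuous_onI)
  have iso: "norm (U x) = norm x" for x using U by (rule orthogonal_transformation_norm)
  obtain V where V: "\<And>x. U (V x) = x"
    using orthogonal_transformation_surj[OF U] by (metis surj_def)
  show ?thesis
  proof (rule translation_invariant_eq_lborel)
    show ball: "emeasure (distr lborel borel U) (cball c 1) = emeasure lborel (cball c 1)" for c
    proof -
      have "U -` cball c 1 = cball (V c) 1"
        using iso V lin by (auto simp: dist_norm) (metis iso V linear_diff)+
      then show ?thesis by (simp add: emeasure_distr emeasure_cball)
    qed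
    show "sigma_finite_measure (distr lborel borel U)"
    proof (rule sigma_finite_measure.intro, intro exI conjI)
      let ?A = "range (\<lambda>n::nat. cball (0::'a) (real n))"
      show "countable ?A" by simp
      show "?A \<subseteq> sets (distr lborel borel U)" by auto
      show "\<Union>?A = space (distr lborel borel U)"
        by (auto simp: dist_norm) (meson real_arch_simple)
      have "U -` cball 0 r = cball 0 r" for r using iso by auto
      then show "\<forall>a\<in>?A. emeasure (distr lborel borel U) a \<noteq> \<infinity>"
        by (auto simp: emeasure_distr emeasure_cball)
    qed
    show "distr (distr lborel borel U) borel (\<lambda>x. t + x) = distr lborel borel U" for t
    proof -
      have "distr (distr lborel borel U) borel (\<lambda>x. t + x) = distr lborel borel (\<lambda>x. U (V t + x))"
        by (simp add: distr_distr comp_def linear_add[OF lin] V)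
      also have "\<dots> = distr (distr lborel borel (\<lambda>x. V t + x)) borel U"
        by (simp add: distr_distr comp_def)
      finally show ?thesis by (simp add: lborel_distr_translate)
    qed
  qed simp
qed

text \<open>Householder reflection in the hyperplane orthogonal to \<open>a - b\<close>. A
  reflection, unlike a rotation, also serves in dimension one, which is the case n = 2.\<close>

lemma reflection_exists:
  fixes a b :: "'a::euclidean_space"
  assumes "norm a = norm b"
  obtains U where "orthogonal_transformation U" "U a = b"
proof (cases "a = b")
  case True
  then show ?thesis using that[of "\<lambda>x. x"] by (auto simp: orthogonal_transformation_def linear_id[unfolded id_def])
next
  case False
  define w where "w = a - b"
  define U where "U x = x - (2 * (x \<bullet> w) / (w \<bullet> w)) *\<^sub>R w" for x
  have w: "w \<bullet> w \<noteq> 0" using False by (simp add: w_def)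
  have "linear U"
    by (rule linearI) (auto simp: U_def inner_add_left algebra_simps add_divide_distrib scaleR_add_left)
  moreover have "U x \<bullet> U y = x \<bullet> y" for x y
    using w by (simp add: U_def inner_diff_left inner_diff_right inner_commute field_simps)
  moreover have "U a = b"
  proof -
    have "a \<bullet> a = b \<bullet> b" using assms by (simp add: norm_eq)
    then have "2 * (a \<bullet> w) = w \<bullet> w" by (simp add: w_def inner_diff_left inner_diff_right inner_commute)
    then show ?thesis using w by (simp add: U_def w_def)
  qed
  ultimately show ?thesis using that by (auto simp: orthogonal_transformation_def)
qed

text \<open>For fixed \<open>y\<close> the shear is a translation in \<open>x\<close>, so Fubini
  with \<open>y\<close> outermost reduces it to translation invariance. It straightens the planes
  over which the cone transform integrates.\<close>

lemma lborel_distr_shear: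
  "distr lborel borel (\<lambda>(x, y). (x + s *\<^sub>R y, y)) = (lborel :: ('a::euclidean_space \<times> 'a) measure)"
    (is "distr lborel borel ?S = _")
proof (rule measure_eqI)
  fix E :: "('a \<times> 'a) set"
  assume "E \<in> sets (distr lborel borel ?S)"
  then have [measurable]: "E \<in> sets borel" by simp
  have [measurable]: "E \<in> sets (lborel \<Otimes>\<^sub>M lborel)" by (subst lborel_prod) simp
  have [measurable]: "?S \<in> borel_measurable borel"
    by (simp add: borel_prod[symmetric])
  have "emeasure (distr lborel borel ?S) E = (\<integral>\<^sup>+p. indicator E p \<partial>distr lborel borel ?S)"
    by simp
  also have "\<dots> = (\<integral>\<^sup>+p. indicator E (?S p) \<partial>lborel)"
    by (rule nn_integral_distr) auto
  also have "\<dots> = (\<integral>\<^sup>+p. indicator E (?S p) \<partial>(lborel \<Otimes>\<^sub>M lborel))"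
    by (simp add: lborel_prod)
  also have "\<dots> = (\<integral>\<^sup>+y. (\<integral>\<^sup>+x. indicator E (s *\<^sub>R y + x, y) \<partial>lborel) \<partial>lborel)"
    by (subst lborel_pair.nn_integral_snd[symmetric]) (simp_all add: add.commute)
  also have "\<dots> = (\<integral>\<^sup>+y. (\<integral>\<^sup>+x. indicator E (x, y) \<partial>lborel) \<partial>lborel)"
  proof (rule nn_integral_cong)
    fix y :: 'a
    have "(\<lambda>x. indicator E (x, y) :: ennreal) \<in> borel_measurable borel" by measurable
    then show "(\<integral>\<^sup>+x. indicator E (s *\<^sub>R y + x, y) \<partial>lborel) = (\<integral>\<^sup>+x. indicator E (x, y) \<partial>lborel)"
      by (rule nn_integral_lborel_translate)
  qed
  also have "\<dots> = (\<integral>\<^sup>+p. indicator E p \<partial>(lborel \<Otimes>\<^sub>M lborel))"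
    by (subst lborel_pair.nn_integral_snd[symmetric]) simp_all
  also have "\<dots> = emeasure lborel E" by (simp add: lborel_prod)
  finally show "emeasure (distr lborel borel ?S) E = emeasure lborel E" .
qed simp

section \<open>Truncated powers and rapid decay\<close>

text \<open>The case distinction matters for \<open>k = 0\<close>: \<open>max 0 t ^ 0\<close> would
  be 1 everywhere, whereas the exponent 0 has to give the indicator of \<open>t > 0\<close>, the
  last member of the chain of derivatives.\<close>

definition pos_pow :: "nat \<Rightarrow> real \<Rightarrow> real" where
  "pos_pow k t = (if t > 0 then t ^ k else 0)"

lemma pos_pow_measurable [measurable]: "pos_pow k \<in> borel_measurable borel"
  unfolding pos_pow_def [abs_def] by measurable

lemma pos_pow_bound: "\<bar>pos_pow k t\<bar> \<le> (1 + \<bar>t\<bar>) ^ k"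
  by (auto simp: pos_pow_def power_abs intro!: power_mono)

text \<open>Serves to dominate difference quotients. Clamping at 0 is 1-Lipschitz, which leaves
  nonnegative arguments, and for those one factor is split off in each step of the
  induction.\<close>

lemma pos_pow_Suc_lipschitz:
  assumes "\<bar>a\<bar> \<le> M" "\<bar>b\<bar> \<le> M"
  shows "\<bar>pos_pow (Suc k) a - pos_pow (Suc k) b\<bar> \<le> real (Suc k) * \<bar>a - b\<bar> * M ^ k"
proof -
  have *: "\<bar>a ^ Suc k - b ^ Suc k\<bar> \<le> real (Suc k) * \<bar>a - b\<bar> * M ^ k"
    if "0 \<le> a" "0 \<le> b" "a \<le> M" "b \<le> M" for a b :: real
  proof (induction k)
    case (Suc k)
    have M: "0 \<le> M" using that by linarith
    have "\<bar>a ^ Suc (Suc k) - b ^ Suc (Suc k)\<bar> = \<bar>a * (a ^ Suc k - b ^ Suc k) + (a - b) * b ^ Suc k\<bar>"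
      by (simp add: algebra_simps)
    also have "\<dots> \<le> \<bar>a\<bar> * \<bar>a ^ Suc k - b ^ Suc k\<bar> + \<bar>a - b\<bar> * \<bar>b ^ Suc k\<bar>"
      by (metis abs_mult abs_triangle_ineq)
    also have "\<dots> \<le> M * (real (Suc k) * \<bar>a - b\<bar> * M ^ k) + \<bar>a - b\<bar> * M ^ Suc k"
      using that Suc M by (intro add_mono mult_mono) (auto simp: abs_mult intro!: mult_mono power_mono)
    also have "\<dots> = real (Suc (Suc k)) * \<bar>a - b\<bar> * M ^ Suc k"
      by (simp add: algebra_simps)
    finally show ?case .
  qed simp
  have M: "0 \<le> M" using assms by linarith
  have "pos_pow (Suc k) t = max 0 t ^ Suc k" for t by (auto simp: pos_pow_def max_def)
  then have "\<bar>pos_pow (Suc k) a - pos_pow (Suc k) b\<bar> \<le> real (Suc k) * \<bar>max 0 a - max 0 b\<bar> * M ^ k"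
    using *[of "max 0 a" "max 0 b"] assms M by (simp del: power_Suc)
  also have "\<dots> \<le> real (Suc k) * \<bar>a - b\<bar> * M ^ k"
    using M by (intro mult_right_mono mult_left_mono) auto
  finally show ?thesis .
qed

text \<open>The only obstruction is the kink of \<open>pos_pow 1\<close> at 0. For
  \<open>k > 0\<close> the difference quotient at 0 is at most \<open>\<bar>h\<bar> ^ k\<close> in
  absolute value.\<close>

lemma pos_pow_Suc_has_derivative:
  assumes "k = 0 \<longrightarrow> t \<noteq> 0"
  shows "(pos_pow (Suc k) has_real_derivative real (Suc k) * pos_pow k t) (at t)"
proof -
  consider "t > 0" | "t < 0" | "t = 0" "k > 0" using assms by fastforce
  then show ?thesis
  proof cases
    case 1
    have "((\<lambda>t. t ^ Suc k) has_real_derivative real (Suc k) * pos_pow k t) (at t)"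
      using 1 DERIV_pow[of "Suc k" t] by (simp add: pos_pow_def)
    then show ?thesis
      by (rule has_field_derivative_transform_within_open[where S="{0<..}"]) (use 1 in \<open>auto simp: pos_pow_def\<close>)
  next
    case 2
    have "((\<lambda>t. 0) has_real_derivative real (Suc k) * pos_pow k t) (at t)"
      using 2 by (auto simp: pos_pow_def)
    then show ?thesis
      by (rule has_field_derivative_transform_within_open[where S="{..<0}"]) (use 2 in \<open>auto simp: pos_pow_def\<close>)
  next
    case 3
    have "(\<lambda>h. pos_pow (Suc k) h / h) \<midarrow>0\<rightarrow> 0"
    proof (rule tendsto_0_le)
      show "(\<lambda>h::real. h ^ k) \<midarrow>0\<rightarrow> 0"
        using 3 by (auto intro!: tendsto_eq_intros)
      show "\<forall>\<^sub>F h in at 0. norm (pos_pow (Suc k) h / h) \<le> norm (h ^ k) * 1"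
        by (auto simp: pos_pow_def abs_mult)
    qed
    then show ?thesis using 3 by (simp add: DERIV_def pos_pow_def)
  qed
qed

text \<open>Differentiation of \<open>\<integral> (\<alpha> + \<tau> \<beta>)\<^sub>+\<^sup>k\<^sup>+\<^sup>1 \<phi>\<close> under the integral at \<open>\<tau> = 0\<close>, from the right.\<close>
lemma integral_pos_pow_derivative_zero:
  fixes \<phi> :: "'a::euclidean_space \<Rightarrow> complex" and \<alpha> \<beta> :: "'a \<Rightarrow> real"
  assumes [measurable]: "\<phi> \<in> borel_measurable borel" "\<alpha> \<in> borel_measurable borel" "\<beta> \<in> borel_measurable borel"
    and int: "integrable lborel (\<lambda>x. (1 + \<bar>\<alpha> x\<bar> + \<bar>\<beta> x\<bar>) ^ Suc k *\<^sub>R \<phi> x)"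
    and "\<epsilon> > 0"
    and zero: "\<And>\<tau>. 0 \<le> \<tau> \<Longrightarrow> \<tau> < \<epsilon> \<Longrightarrow> (LINT x|lborel. pos_pow (Suc k) (\<alpha> x + \<tau> * \<beta> x) *\<^sub>R \<phi> x) = 0"
    and ae: "k = 0 \<Longrightarrow> AE x in lborel. \<alpha> x \<noteq> 0"
  shows "(LINT x|lborel. pos_pow k (\<alpha> x) *\<^sub>R (\<beta> x *\<^sub>R \<phi> x)) = 0"
proof -
  define M where "M x = 1 + \<bar>\<alpha> x\<bar> + \<bar>\<beta> x\<bar>" for x
  \<comment> \<open>Step sizes below \<open>\<epsilon>\<close>, where \<open>zero\<close> applies,
    and at most 1, so that \<open>\<bar>\<alpha>\<bar> + \<bar>\<beta>\<bar>\<close> dominates the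
    shifted argument for every \<open>n\<close>.\<close>
  define \<tau> where "\<tau> n = min 1 (\<epsilon> / 2) / real (Suc n)" for n
  have \<tau>: "0 < \<tau> n" "\<tau> n < \<epsilon>" "\<tau> n \<le> 1" for n
  proof -
    show "0 < \<tau> n" using \<open>\<epsilon> > 0\<close> by (simp add: \<tau>_def)
    have "\<tau> n \<le> min 1 (\<epsilon> / 2) / 1"
      unfolding \<tau>_def using \<open>\<epsilon> > 0\<close> by (intro divide_left_mono) auto
    then show "\<tau> n < \<epsilon>" "\<tau> n \<le> 1" using \<open>\<epsilon> > 0\<close> by auto
  qed
  have lim: "\<tau> \<longlonglongrightarrow> 0"
    unfolding \<tau>_def by (rule LIMSEQ_Suc, rule lim_const_over_n)
  define q where "q n x = ((pos_pow (Suc k) (\<alpha> x + \<tau> n * \<beta> x) - pos_pow (Suc k) (\<alpha> x)) / \<tau> n) *\<^sub>R \<phi> x" for n x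
  have intp: "integrable lborel (\<lambda>x. pos_pow (Suc k) (\<alpha> x + t * \<beta> x) *\<^sub>R \<phi> x)" if "0 \<le> t" "t \<le> 1" for t
  proof (rule Bochner_Integration.integrable_bound[OF int])
    show "AE x in lborel. norm (pos_pow (Suc k) (\<alpha> x + t * \<beta> x) *\<^sub>R \<phi> x) \<le> norm ((1 + \<bar>\<alpha> x\<bar> + \<bar>\<beta> x\<bar>) ^ Suc k *\<^sub>R \<phi> x)"
    proof (intro AE_I2)
      fix x
      have "t * \<bar>\<beta> x\<bar> \<le> \<bar>\<beta> x\<bar>" using that by (intro mult_left_le_one_le) auto
      then have "\<bar>\<alpha> x + t * \<beta> x\<bar> \<le> \<bar>\<alpha> x\<bar> + \<bar>\<beta> x\<bar>"
        using that abs_triangle_ineq[of "\<alpha> x" "t * \<beta> x"] by (simp add: abs_mult)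
      then have "\<bar>pos_pow (Suc k) (\<alpha> x + t * \<beta> x)\<bar> \<le> (1 + \<bar>\<alpha> x\<bar> + \<bar>\<beta> x\<bar>) ^ Suc k"
        by (intro order_trans[OF pos_pow_bound] power_mono) auto
      then show "norm (pos_pow (Suc k) (\<alpha> x + t * \<beta> x) *\<^sub>R \<phi> x) \<le> norm ((1 + \<bar>\<alpha> x\<bar> + \<bar>\<beta> x\<bar>) ^ Suc k *\<^sub>R \<phi> x)"
        by (auto simp del: power_Suc simp: abs_mult power_abs intro!: mult_right_mono)
    qed
  qed measurable
  have q0: "(LINT x|lborel. q n x) = 0" for n
  proof -
    have "q n x = (1 / \<tau> n) *\<^sub>R (pos_pow (Suc k) (\<alpha> x + \<tau> n * \<beta> x) *\<^sub>R \<phi> x - pos_pow (Suc k) (\<alpha> x + 0 * \<beta> x) *\<^sub>R \<phi> x)" for x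
      by (simp add: q_def scaleR_diff_left diff_divide_distrib scaleR_diff_right)
    then have "(LINT x|lborel. q n x) = (1 / \<tau> n) *\<^sub>R ((LINT x|lborel. pos_pow (Suc k) (\<alpha> x + \<tau> n * \<beta> x) *\<^sub>R \<phi> x)
       - (LINT x|lborel. pos_pow (Suc k) (\<alpha> x + 0 * \<beta> x) *\<^sub>R \<phi> x))"
      using intp[of "\<tau> n"] intp[of 0] \<tau>[of n] by (simp del: mult_zero_left add: less_imp_le)
    then show ?thesis using zero[of "\<tau> n"] zero[of 0] \<tau>[of n] \<open>\<epsilon> > 0\<close> by (simp del: mult_zero_left add: less_imp_le)
  qed
  have "(\<lambda>n. LINT x|lborel. q n x) \<longlonglongrightarrow> (LINT x|lborel. (real (Suc k) * pos_pow k (\<alpha> x) * \<beta> x) *\<^sub>R \<phi> x)"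
  proof (rule integral_dominated_convergence)
    show "integrable lborel (\<lambda>x. real (Suc k) * norm (M x ^ Suc k *\<^sub>R \<phi> x))"
      using int by (intro integrable_mult_right integrable_norm) (simp add: M_def)
    show "AE x in lborel. norm (q n x) \<le> real (Suc k) * norm (M x ^ Suc k *\<^sub>R \<phi> x)" for n
    proof (intro AE_I2)
      fix x
      have "\<tau> n * \<bar>\<beta> x\<bar> \<le> \<bar>\<beta> x\<bar>" using \<tau>[of n] by (intro mult_left_le_one_le) auto
      then have "\<bar>\<alpha> x + \<tau> n * \<beta> x\<bar> \<le> M x"
        using \<tau>[of n] abs_triangle_ineq[of "\<alpha> x" "\<tau> n * \<beta> x"] by (simp add: M_def abs_mult)
      moreover have "\<bar>\<alpha> x\<bar> \<le> M x" by (simp add: M_def)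
      ultimately have "\<bar>pos_pow (Suc k) (\<alpha> x + \<tau> n * \<beta> x) - pos_pow (Suc k) (\<alpha> x)\<bar>
           \<le> real (Suc k) * (\<tau> n * \<bar>\<beta> x\<bar>) * M x ^ k"
        using pos_pow_Suc_lipschitz[of "\<alpha> x + \<tau> n * \<beta> x" "M x" "\<alpha> x" k] \<tau>(1)[of n]
        by (simp add: abs_mult)
      then have "\<bar>(pos_pow (Suc k) (\<alpha> x + \<tau> n * \<beta> x) - pos_pow (Suc k) (\<alpha> x)) / \<tau> n\<bar>
           \<le> real (Suc k) * \<bar>\<beta> x\<bar> * M x ^ k"
        using \<tau>(1)[of n] by (simp add: abs_divide field_simps)
      also have "\<dots> \<le> real (Suc k) * M x * M x ^ k"
        by (intro mult_right_mono mult_left_mono) (auto simp: M_def)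
      finally have "\<bar>(pos_pow (Suc k) (\<alpha> x + \<tau> n * \<beta> x) - pos_pow (Suc k) (\<alpha> x)) / \<tau> n\<bar>
           \<le> real (Suc k) * \<bar>M x ^ Suc k\<bar>" by (simp add: M_def abs_mult mult.assoc)
      then show "norm (q n x) \<le> real (Suc k) * norm (M x ^ Suc k *\<^sub>R \<phi> x)"
        unfolding q_def norm_scaleR mult.assoc[symmetric] by (rule mult_right_mono) simp
    qed
    have "AE x in lborel. k = 0 \<longrightarrow> \<alpha> x \<noteq> 0" using ae by (cases "k = 0") auto
    then show "AE x in lborel. (\<lambda>n. q n x) \<longlonglongrightarrow> (real (Suc k) * pos_pow k (\<alpha> x) * \<beta> x) *\<^sub>R \<phi> x"
    proof eventually_elim
      case (elim x)
      have "((\<lambda>t. \<alpha> x + t * \<beta> x) has_real_derivative \<beta> x) (at 0)"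
        by (auto intro!: derivative_eq_intros)
      then have D: "((\<lambda>t. pos_pow (Suc k) (\<alpha> x + t * \<beta> x)) has_real_derivative (real (Suc k) * pos_pow k (\<alpha> x)) * \<beta> x) (at 0)"
        using DERIV_chain2[where f="pos_pow (Suc k)" and g="\<lambda>t. \<alpha> x + t * \<beta> x" and x=0]
          pos_pow_Suc_has_derivative[of k "\<alpha> x"] elim
        by simp
      then have "((\<lambda>t. (pos_pow (Suc k) (\<alpha> x + t * \<beta> x) - pos_pow (Suc k) (\<alpha> x)) / t) \<longlongrightarrow> real (Suc k) * pos_pow k (\<alpha> x) * \<beta> x) (at 0)"
        by (simp add: DERIV_def)
      moreover have "filterlim \<tau> (at 0) sequentially"
        using lim \<tau>(1) by (auto simp: filterlim_at intro!: always_eventually) (metis less_irrefl)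
      ultimately have "(\<lambda>n. (pos_pow (Suc k) (\<alpha> x + \<tau> n * \<beta> x) - pos_pow (Suc k) (\<alpha> x)) / \<tau> n)
         \<longlonglongrightarrow> real (Suc k) * pos_pow k (\<alpha> x) * \<beta> x"
        by (rule filterlim_compose)
      then show ?case unfolding q_def by (intro tendsto_intros)
    qed
  qed (auto simp: q_def)
  then have "(LINT x|lborel. (real (Suc k) * pos_pow k (\<alpha> x) * \<beta> x) *\<^sub>R \<phi> x) = 0"
    by (simp add: q0 LIMSEQ_const_iff)
  moreover have "(LINT x|lborel. (real (Suc k) * pos_pow k (\<alpha> x) * \<beta> x) *\<^sub>R \<phi> x)
     = real (Suc k) *\<^sub>R (LINT x|lborel. pos_pow k (\<alpha> x) *\<^sub>R (\<beta> x *\<^sub>R \<phi> x))"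
    unfolding integral_scaleR_right[symmetric] by (simp add: mult.assoc)
  ultimately show ?thesis by simp
qed

section \<open>Functions with absolute moments of all orders\<close>

definition rapid_decay :: "('a::euclidean_space \<Rightarrow> complex) \<Rightarrow> bool" where
  "rapid_decay \<phi> \<longleftrightarrow> \<phi> \<in> borel_measurable borel \<and>
     (\<forall>k. integrable lborel (\<lambda>x. (1 + norm x) ^ k *\<^sub>R \<phi> x))"

lemma rapid_decay_measurable [measurable_dest]: "rapid_decay \<phi> \<Longrightarrow> \<phi> \<in> borel_measurable borel"
  by (simp add: rapid_decay_def)

lemma rapid_decay_integrable_mult:
  fixes w :: "'a::euclidean_space \<Rightarrow> real"
  assumes "rapid_decay \<phi>" and [measurable]: "w \<in> borel_measurable borel"
    and w: "\<And>x. \<bar>w x\<bar> \<le> C * (1 + norm x) ^ k"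
  shows "integrable lborel (\<lambda>x. w x *\<^sub>R \<phi> x)"
proof -
  have [measurable]: "\<phi> \<in> borel_measurable borel" using assms(1) by measurable
  show ?thesis
  proof (rule Bochner_Integration.integrable_bound)
    show "integrable lborel (\<lambda>x. C *\<^sub>R (1 + norm x) ^ k *\<^sub>R \<phi> x)"
      using assms(1) unfolding rapid_decay_def by (intro integrable_scaleR_right) auto
    show "AE x in lborel. norm (w x *\<^sub>R \<phi> x) \<le> norm (C *\<^sub>R (1 + norm x) ^ k *\<^sub>R \<phi> x)"
    proof (intro AE_I2)
      fix x
      have "\<bar>w x\<bar> \<le> \<bar>C\<bar> * \<bar>(1 + norm x) ^ k\<bar>"
        using w[of x] by (metis abs_ge_self abs_mult order_trans)
      then show "norm (w x *\<^sub>R \<phi> x) \<le> norm (C *\<^sub>R (1 + norm x) ^ k *\<^sub>R \<phi> x)"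
        unfolding norm_scaleR mult.assoc[symmetric] by (rule mult_right_mono) simp
    qed
  qed measurable
qed

lemma rapid_decay_mult:
  fixes w :: "'a::euclidean_space \<Rightarrow> real"
  assumes "rapid_decay \<phi>" and [measurable]: "w \<in> borel_measurable borel"
    and w: "\<And>x. \<bar>w x\<bar> \<le> C * (1 + norm x) ^ k"
  shows "rapid_decay (\<lambda>x. w x *\<^sub>R \<phi> x)"
  unfolding rapid_decay_def
proof (intro conjI allI)
  have [measurable]: "\<phi> \<in> borel_measurable borel" using assms(1) by measurable
  show "(\<lambda>x. w x *\<^sub>R \<phi> x) \<in> borel_measurable borel" by measurable
  fix j
  have "integrable lborel (\<lambda>x. ((1 + norm x) ^ j * w x) *\<^sub>R \<phi> x)"
  proof (rule rapid_decay_integrable_mult[OF assms(1)])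
    fix x
    have "\<bar>(1 + norm x) ^ j * w x\<bar> = (1 + norm x) ^ j * \<bar>w x\<bar>" by (simp add: abs_mult)
    also have "\<dots> \<le> (1 + norm x) ^ j * (C * (1 + norm x) ^ k)" using w by (intro mult_left_mono) auto
    finally show "\<bar>(1 + norm x) ^ j * w x\<bar> \<le> C * (1 + norm x) ^ (j + k)"
      by (simp add: power_add mult_ac)
  qed measurable
  then show "integrable lborel (\<lambda>x. (1 + norm x) ^ j *\<^sub>R w x *\<^sub>R \<phi> x)" by simp
qed

lemma rapid_decay_add: "rapid_decay \<phi> \<Longrightarrow> rapid_decay \<psi> \<Longrightarrow> rapid_decay (\<lambda>x. \<phi> x + \<psi> x)"
  by (auto simp: rapid_decay_def scaleR_add_right)

text \<open>\<open>(1 + norm x)\<^sup>-\<^sup>(\<^sup>d\<^sup>+\<^sup>2\<^sup>)\<close> is compared with a series of multiples of indicators of balls of integer radius.\<close>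
lemma integrable_inverse_power_norm:
  "integrable lborel (\<lambda>x::'a::euclidean_space. 1 / (1 + norm x) ^ (DIM('a) + 2))"
proof (rule integrableI_bounded)
  let ?d = "DIM('a)"
  define V where "V = unit_ball_vol (real ?d)"
  have V: "V \<ge> 0" by (simp add: V_def)
  have "(\<integral>\<^sup>+(x::'a). ennreal (norm (1 / (1 + norm x) ^ (?d + 2))) \<partial>lborel)
     \<le> (\<integral>\<^sup>+(x::'a). (\<Sum>n. ennreal (1 / real (Suc n) ^ (?d + 2)) * indicator (cball 0 (real (Suc n))) x) \<partial>lborel)"
  proof (rule nn_integral_mono)
    fix x :: 'a
    have le_suminf: "t n \<le> suminf t" for t :: "nat \<Rightarrow> ennreal" and n
      using sum_le_suminf[of t "{n}"] by simp
    \<comment> \<open>The single term with this index already dominates: \<open>x\<close> lies in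
      the ball of radius \<open>Suc n\<close>, and \<open>Suc n\<close> is at most
      \<open>1 + norm x\<close>.\<close>
    define n where "n = nat \<lfloor>norm x\<rfloor>"
    have n: "real n \<le> norm x" "norm x \<le> real (Suc n)" by (auto simp: n_def) linarith
    have "real (Suc n) ^ (?d + 2) \<le> (1 + norm x) ^ (?d + 2)"
      using n by (intro power_mono) auto
    then have "1 / (1 + norm x) ^ (?d + 2) \<le> 1 / real (Suc n) ^ (?d + 2)"
      by (intro frac_le) auto
    then have "ennreal (norm (1 / (1 + norm x) ^ (?d + 2))) \<le> ennreal (1 / real (Suc n) ^ (?d + 2))"
      by (intro ennreal_leI) (simp del: power_Suc add: power_add)
    also have "\<dots> = ennreal (1 / real (Suc n) ^ (?d + 2)) * indicator (cball 0 (real (Suc n))) x"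
      using n by simp
    also have "\<dots> \<le> (\<Sum>n. ennreal (1 / real (Suc n) ^ (?d + 2)) * indicator (cball 0 (real (Suc n))) x)"
      by (rule le_suminf)
    finally show "ennreal (norm (1 / (1 + norm x) ^ (?d + 2))) \<le> \<dots>" .
  qed
  also have "\<dots> = (\<Sum>n. ennreal (1 / real (Suc n) ^ (?d + 2)) * emeasure lborel (cball (0::'a) (real (Suc n))))"
  proof (subst nn_integral_suminf)
    show "(\<lambda>x. ennreal (1 / real (Suc n) ^ (?d + 2)) * indicator (cball (0::'a) (real (Suc n))) x) \<in> borel_measurable lborel" for n
      by (intro borel_measurable_times_ennreal borel_measurable_const borel_measurable_indicator) simp
  qed (simp only: nn_integral_cmult_indicator sets_lborel borel_closed closed_cball)
  also have "\<dots> = (\<Sum>n. ennreal (V * (1 / real (Suc n) ^ 2)))"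
  proof (intro arg_cong[where f=suminf] ext)
    fix n
    \<comment> \<open>The volume of the ball uses up \<open>DIM('a)\<close> powers; the two extra
      ones leave a convergent series of inverse squares.\<close>
    have "1 / real (Suc n) ^ (?d + 2) * (V * real (Suc n) ^ ?d) = V * (1 / real (Suc n) ^ 2)"
      by (simp add: power_add field_simps power2_eq_square del: of_nat_Suc)
    then show "ennreal (1 / real (Suc n) ^ (?d + 2)) * emeasure lborel (cball (0::'a) (real (Suc n))) = ennreal (V * (1 / real (Suc n) ^ 2))"
      using V by (simp add: emeasure_cball V_def[symmetric] ennreal_mult[symmetric] del: of_nat_Suc)
  qed
  also have "\<dots> < \<infinity>"
  proof -
    have "summable (\<lambda>n. V * (1 / real (Suc n) ^ 2))"
      using inverse_power_summable[of 2, where 'a=real]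
      by (intro summable_mult) (subst summable_Suc_iff, simp add: inverse_eq_divide)
    then have "(\<Sum>n. ennreal (V * (1 / real (Suc n) ^ 2))) \<noteq> top" using V
      by (intro ennreal_suminf_neq_top) auto
    then show ?thesis by (simp add: top.not_eq_extremum)
  qed
  finally show "(\<integral>\<^sup>+(x::'a). ennreal (norm (1 / (1 + norm x) ^ (?d + 2))) \<partial>lborel) < \<infinity>" .
qed measurable

lemma rapid_decayI:
  fixes \<phi> :: "'a::euclidean_space \<Rightarrow> complex"
  assumes cont: "continuous_on UNIV \<phi>"
    and bd: "\<And>k. bounded (range (\<lambda>x. norm x ^ k *\<^sub>R \<phi> x))"
  shows "rapid_decay \<phi>"
  unfolding rapid_decay_def
proof (intro conjI allI)
  show [measurable]: "\<phi> \<in> borel_measurable borel" using cont by (rule borel_measurable_continuous_onI)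
  fix k
  let ?K = "k + (DIM('a) + 2)"
  obtain B0 where B0: "\<And>x. norm (norm x ^ 0 *\<^sub>R \<phi> x) \<le> B0" using bd[of 0] by (auto simp: bounded_iff)
  obtain B1 where B1: "\<And>x. norm (norm x ^ ?K *\<^sub>R \<phi> x) \<le> B1" using bd[of ?K] unfolding bounded_iff by blast
  have bound: "norm ((1 + norm x) ^ ?K *\<^sub>R \<phi> x) \<le> 2 ^ ?K * (B0 + B1)" for x
  proof -
    \<comment> \<open>Since \<open>1 + norm x\<close> is at most twice
      \<open>max 1 (norm x)\<close>, the bounds for the two exponents 0 and \<open>?K\<close> are
      enough.\<close>
    have "(1 + norm x) ^ ?K \<le> (2 * max 1 (norm x)) ^ ?K" by (intro power_mono) auto
    also have "\<dots> = 2 ^ ?K * max 1 (norm x) ^ ?K" by (rule power_mult_distrib)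
    also have "max 1 (norm x) ^ ?K \<le> 1 + norm x ^ ?K" by (auto simp: max_def)
    finally have "(1 + norm x) ^ ?K \<le> 2 ^ ?K * (1 + norm x ^ ?K)" by simp
    then have "norm ((1 + norm x) ^ ?K *\<^sub>R \<phi> x) \<le> 2 ^ ?K * (1 + norm x ^ ?K) * norm (\<phi> x)"
      by (auto intro!: mult_right_mono)
    also have "\<dots> = 2 ^ ?K * (norm (norm x ^ 0 *\<^sub>R \<phi> x) + norm (norm x ^ ?K *\<^sub>R \<phi> x))"
      by (simp add: algebra_simps)
    also have "\<dots> \<le> 2 ^ ?K * (B0 + B1)" using B0 B1 by (intro mult_left_mono add_mono) auto
    finally show ?thesis .
  qed
  show "integrable lborel (\<lambda>x. (1 + norm x) ^ k *\<^sub>R \<phi> x)"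
  proof (rule Bochner_Integration.integrable_bound)
    show "integrable lborel (\<lambda>x::'a. (2 ^ ?K * (B0 + B1)) * (1 / (1 + norm x) ^ (DIM('a) + 2)))"
      by (intro integrable_mult_right integrable_inverse_power_norm)
    show "AE x in lborel. norm ((1 + norm x) ^ k *\<^sub>R \<phi> x) \<le> norm ((2 ^ ?K * (B0 + B1)) * (1 / (1 + norm x) ^ (DIM('a) + 2)))"
    proof (intro AE_I2)
      fix x :: 'a
      have "norm ((1 + norm x) ^ ?K *\<^sub>R \<phi> x) = (1 + norm x) ^ (DIM('a) + 2) * norm ((1 + norm x) ^ k *\<^sub>R \<phi> x)"
        by (simp add: power_add)
      moreover have "(1 + norm x) ^ (DIM('a) + 2) > 0" by (simp add: add_pos_nonneg)
      ultimately have "norm ((1 + norm x) ^ k *\<^sub>R \<phi> x) \<le> (2 ^ ?K * (B0 + B1)) * (1 / (1 + norm x) ^ (DIM('a) + 2))"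
        using bound[of x] unfolding times_divide_eq_right mult_1_right
        by (metis pos_le_divide_eq mult.commute)
      then show "norm ((1 + norm x) ^ k *\<^sub>R \<phi> x) \<le> norm ((2 ^ ?K * (B0 + B1)) * (1 / (1 + norm x) ^ (DIM('a) + 2)))"
        by (metis abs_ge_self order_trans real_norm_def)
    qed
  qed measurable
qed

section \<open>Vanishing on exterior half spaces\<close>

lemma AE_lborel_of_negligible:
  fixes S :: "'a::euclidean_space set"
  assumes "negligible S" "S \<in> sets borel"
  shows "AE x in lborel. x \<notin> S"
proof -
  have "S \<in> null_sets lborel"
    using assms null_sets_completion_iff[of S lborel] by (simp add: negligible_iff_null_sets)
  then show ?thesis by (rule AE_not_in)
qed

text \<open>For \<open>\<xi> \<noteq> 0\<close> the half space \<open>x \<bullet> \<xi> > c\<close>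
  lies at distance \<open>c / norm \<xi> > 1\<close> from the origin. The normal is not normalised,
  so it can be varied freely in an open set, and all \<open>k\<close> are required together so that
  the class is stable under differentiation in \<open>\<xi>\<close>.\<close>

definition exterior_null :: "'a::euclidean_space set \<Rightarrow> ('a \<Rightarrow> complex) \<Rightarrow> bool" where
  "exterior_null \<Omega> \<phi> \<longleftrightarrow> rapid_decay \<phi> \<and>
     (\<forall>k c. \<forall>\<xi>\<in>\<Omega>. norm \<xi> < c \<longrightarrow> (LINT x|lborel. pos_pow k (x \<bullet> \<xi> - c) *\<^sub>R \<phi> x) = 0)"

lemma affine_growth:
  fixes \<xi> w :: "'a::euclidean_space"
  shows "1 + \<bar>x \<bullet> \<xi> - c\<bar> + \<bar>x \<bullet> w\<bar> \<le> (1 + norm \<xi> + \<bar>c\<bar> + norm w) * (1 + norm x)"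
proof -
  have "\<bar>x \<bullet> \<xi>\<bar> \<le> norm x * norm \<xi>" "\<bar>x \<bullet> w\<bar> \<le> norm x * norm w"
    by (rule Cauchy_Schwarz_ineq2)+
  moreover have "0 \<le> \<bar>c\<bar> * norm x" by simp
  moreover have "\<bar>x \<bullet> \<xi> - c\<bar> \<le> \<bar>x \<bullet> \<xi>\<bar> + \<bar>c\<bar>" by (rule abs_triangle_ineq4)
  moreover have "(1 + norm \<xi> + \<bar>c\<bar> + norm w) * (1 + norm x)
      = 1 + norm \<xi> + \<bar>c\<bar> + norm w + norm x + norm x * norm \<xi> + \<bar>c\<bar> * norm x + norm x * norm w"
    by (simp add: algebra_simps)
  ultimately show ?thesis
    using norm_ge_zero[of x] norm_ge_zero[of \<xi>] norm_ge_zero[of w] by linarith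
qed

lemma pos_pow_affine_growth:
  fixes \<xi> :: "'a::euclidean_space"
  shows "\<bar>pos_pow k (x \<bullet> \<xi> - c)\<bar> \<le> (1 + norm \<xi> + \<bar>c\<bar>) ^ k * (1 + norm x) ^ k"
proof -
  have "(1 + \<bar>x \<bullet> \<xi> - c\<bar>) ^ k \<le> ((1 + norm \<xi> + \<bar>c\<bar>) * (1 + norm x)) ^ k"
    using affine_growth[of x \<xi> c 0] by (intro power_mono) auto
  then show ?thesis using pos_pow_bound[of k "x \<bullet> \<xi> - c"] by (simp add: power_mult_distrib)
qed

text \<open>Replace \<open>\<xi>\<close> by \<open>\<xi> + \<tau> *\<^sub>R w\<close> in the
  condition for \<open>Suc k\<close> and differentiate at \<open>\<tau> = 0\<close>: the chain rule
  supplies the factor \<open>x \<bullet> w\<close> and lowers the exponent to \<open>k\<close>.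
  Openness of \<open>\<Omega>\<close> and of the condition \<open>norm \<xi> < c\<close> keeps the
  moved normal admissible.\<close>

lemma exterior_null_mult_inner:
  fixes \<phi> :: "'a::euclidean_space \<Rightarrow> complex"
  assumes \<phi>: "exterior_null \<Omega> \<phi>" and "open \<Omega>"
  shows "exterior_null \<Omega> (\<lambda>x. (x \<bullet> w) *\<^sub>R \<phi> x)"
  unfolding exterior_null_def
proof (intro conjI allI ballI impI)
  have rd: "rapid_decay \<phi>" using \<phi> by (simp add: exterior_null_def)
  then have [measurable]: "\<phi> \<in> borel_measurable borel" by measurable
  have bw: "\<bar>x \<bullet> w\<bar> \<le> norm w * (1 + norm x) ^ 1" for x
    using Cauchy_Schwarz_ineq2[of x w] by (simp add: algebra_simps) (smt (verit) norm_ge_zero)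
  show "rapid_decay (\<lambda>x. (x \<bullet> w) *\<^sub>R \<phi> x)"
    by (rule rapid_decay_mult[OF rd _ bw]) measurable
  fix k c \<xi> assume \<xi>: "\<xi> \<in> \<Omega>" "norm \<xi> < c"
  have "open (\<Omega> \<inter> ball 0 c)" using \<open>open \<Omega>\<close> by auto
  moreover have "\<xi> \<in> \<Omega> \<inter> ball 0 c" using \<xi> by simp
  ultimately obtain e where e: "e > 0" "ball \<xi> e \<subseteq> \<Omega> \<inter> ball 0 c" by (meson open_contains_ball)
  show "(LINT x|lborel. pos_pow k (x \<bullet> \<xi> - c) *\<^sub>R ((x \<bullet> w) *\<^sub>R \<phi> x)) = 0"
  \<comment> \<open>The 1 added to \<open>norm w\<close> makes \<open>\<epsilon>\<close> meaningful
    for \<open>w = 0\<close> as well.\<close>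
  proof (rule integral_pos_pow_derivative_zero[where \<alpha>="\<lambda>x. x \<bullet> \<xi> - c" and \<beta>="\<lambda>x. x \<bullet> w" and \<epsilon>="e / (norm w + 1)"])
    show "e / (norm w + 1) > 0" using e by (simp add: add_nonneg_pos)
    show "integrable lborel (\<lambda>x. (1 + \<bar>x \<bullet> \<xi> - c\<bar> + \<bar>x \<bullet> w\<bar>) ^ Suc k *\<^sub>R \<phi> x)"
    proof (rule rapid_decay_integrable_mult[OF rd])
      fix x
      have "(1 + \<bar>x \<bullet> \<xi> - c\<bar> + \<bar>x \<bullet> w\<bar>) ^ Suc k \<le> ((1 + norm \<xi> + \<bar>c\<bar> + norm w) * (1 + norm x)) ^ Suc k"
        by (intro power_mono affine_growth) auto
      then show "\<bar>(1 + \<bar>x \<bullet> \<xi> - c\<bar> + \<bar>x \<bullet> w\<bar>) ^ Suc k\<bar> \<le> (1 + norm \<xi> + \<bar>c\<bar> + norm w) ^ Suc k * (1 + norm x) ^ Suc k"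
        unfolding power_abs power_mult_distrib by simp
    qed measurable
    fix \<tau> :: real assume \<tau>: "0 \<le> \<tau>" "\<tau> < e / (norm w + 1)"
    have "norm (\<tau> *\<^sub>R w) < e"
    proof -
      have "\<tau> * (norm w + 1) < e" using \<tau> by (simp add: pos_less_divide_eq add_nonneg_pos)
      then show ?thesis using \<tau> by (simp add: algebra_simps)
    qed
    then have "\<xi> + \<tau> *\<^sub>R w \<in> ball \<xi> e" by (simp add: dist_norm)
    then have "\<xi> + \<tau> *\<^sub>R w \<in> \<Omega>" "norm (\<xi> + \<tau> *\<^sub>R w) < c" using e by auto
    then have "(LINT x|lborel. pos_pow (Suc k) (x \<bullet> (\<xi> + \<tau> *\<^sub>R w) - c) *\<^sub>R \<phi> x) = 0"
      using \<phi> unfolding exterior_null_def by blast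
    then show "(LINT x|lborel. pos_pow (Suc k) (x \<bullet> \<xi> - c + \<tau> * (x \<bullet> w)) *\<^sub>R \<phi> x) = 0"
      by (simp add: inner_add_right algebra_simps)
  next
    \<comment> \<open>With \<open>c \<noteq> 0\<close> the level set is a null set even when
      \<open>\<xi> = 0\<close>, for then it is empty.\<close>
    have "c \<noteq> 0" using \<xi> by (metis norm_ge_zero not_less)
    then have "AE x in lborel. x \<notin> {x. \<xi> \<bullet> x = c}"
      by (intro AE_lborel_of_negligible negligible_hyperplane borel_closed closed_hyperplane) auto
    then show "AE x in lborel. x \<bullet> \<xi> - c \<noteq> 0" by (simp add: inner_commute)
  qed measurable
qed

text \<open>A linear polynomial is an inner product with a fixed vector. For a product the induction
  must range over all \<open>\<phi>\<close>: the hypothesis for \<open>f\<close> is applied to the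
  function \<open>g\<close> times \<open>\<phi>\<close>.\<close>

lemma exterior_null_mult_polynomial:
  fixes \<phi> :: "'a::euclidean_space \<Rightarrow> complex"
  assumes p: "real_polynomial_function p" and "open \<Omega>"
  shows "exterior_null \<Omega> \<phi> \<Longrightarrow> exterior_null \<Omega> (\<lambda>x. p x *\<^sub>R \<phi> x)"
  using p
proof (induction arbitrary: \<phi> rule: real_polynomial_function.induct)
  case (linear f)
  then have lin: "linear f" by (simp add: bounded_linear.linear)
  obtain w where w: "\<And>x. f x = x \<bullet> w"
    using adjoint_works[OF lin, of _ 1] by (metis inner_real_def mult_1_right)
  show ?case unfolding w by (rule exterior_null_mult_inner[OF linear(2) \<open>open \<Omega>\<close>])
next
  case (const c)
  have "rapid_decay (\<lambda>x. c *\<^sub>R \<phi> x)"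
    using const by (intro rapid_decay_mult[where C="\<bar>c\<bar>" and k=0]) (auto simp: exterior_null_def)
  moreover have "(LINT x|lborel. pos_pow k (x \<bullet> \<xi> - d) *\<^sub>R c *\<^sub>R \<phi> x)
      = c *\<^sub>R (LINT x|lborel. pos_pow k (x \<bullet> \<xi> - d) *\<^sub>R \<phi> x)" for k \<xi> d
    unfolding integral_scaleR_right[symmetric] by (simp add: mult.commute)
  ultimately show ?case using const by (simp add: exterior_null_def)
next
  case (add f g)
  have rd: "rapid_decay (\<lambda>x. f x *\<^sub>R \<phi> x)" "rapid_decay (\<lambda>x. g x *\<^sub>R \<phi> x)"
    using add.IH[OF add.prems] by (auto simp: exterior_null_def)
  show ?case unfolding exterior_null_def
  proof (intro conjI allI ballI impI)
    show "rapid_decay (\<lambda>x. (f x + g x) *\<^sub>R \<phi> x)"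
      using rapid_decay_add[OF rd] by (simp add: scaleR_add_left)
    fix k c \<xi> assume \<xi>: "\<xi> \<in> \<Omega>" "norm \<xi> < c"
    have "integrable lborel (\<lambda>x. pos_pow k (x \<bullet> \<xi> - c) *\<^sub>R \<psi> x)" if "rapid_decay \<psi>" for \<psi> :: "'a \<Rightarrow> complex"
      by (rule rapid_decay_integrable_mult[OF that _ pos_pow_affine_growth]) measurable
    from this[OF rd(1)] this[OF rd(2)]
    show "(LINT x|lborel. pos_pow k (x \<bullet> \<xi> - c) *\<^sub>R (f x + g x) *\<^sub>R \<phi> x) = 0"
      using add.IH[OF add.prems] \<xi> unfolding exterior_null_def
      by (simp only: scaleR_add_left scaleR_add_right Bochner_Integration.integral_add) simp
  qed
next
  case (mult f g)
  show ?case using mult.IH(1)[OF mult.IH(2)[OF mult.prems]] by simp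
qed

text \<open>The set of parameters over which half space conditions are superposed. The auxiliary
  coordinate \<open>l\<close> makes the exponent of the resulting kernel an integer in even dimensions.\<close>
definition cone_region :: "real \<Rightarrow> 'a::euclidean_space \<Rightarrow> ('a \<times> real) set" where
  "cone_region s x = {(\<xi>, l). 0 < x \<bullet> \<xi> \<and> x \<bullet> \<xi> \<le> 1 \<and> l\<^sup>2 + s\<^sup>2 * (norm \<xi>)\<^sup>2 < (x \<bullet> \<xi>)\<^sup>2}"

lemma cone_region_measurable [measurable]: "cone_region s x \<in> sets borel"
proof -
  have "cone_region s x = {p \<in> space borel. 0 < x \<bullet> fst p \<and> x \<bullet> fst p \<le> 1 \<and> (snd p)\<^sup>2 + s\<^sup>2 * (norm (fst p))\<^sup>2 < (x \<bullet> fst p)\<^sup>2}"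
    by (auto simp: cone_region_def)
  then show ?thesis by (simp add: borel_prod[symmetric])
qed

text \<open>The truncation \<open>x \<bullet> \<xi> \<le> 1\<close> together with
  \<open>s > 1\<close> confines the parameters to a bounded set that does not depend on
  \<open>x\<close>. This is what makes Fubini applicable below.\<close>

lemma cone_region_subset:
  assumes "s > 1"
  shows "cone_region s (x::'a::euclidean_space) \<subseteq> cball 0 1 \<times> cball 0 1"
proof (rule subsetI)
  fix p assume "p \<in> cone_region s x"
  then obtain \<xi> l where p: "p = (\<xi>, l)" "0 < x \<bullet> \<xi>" "x \<bullet> \<xi> \<le> 1" "l\<^sup>2 + s\<^sup>2 * (norm \<xi>)\<^sup>2 < (x \<bullet> \<xi>)\<^sup>2"
    by (auto simp: cone_region_def)
  have "(x \<bullet> \<xi>)\<^sup>2 \<le> 1" using p by (simp add: power_le_one)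
  moreover have "1 * (norm \<xi>)\<^sup>2 \<le> s\<^sup>2 * (norm \<xi>)\<^sup>2"
    using \<open>s > 1\<close> by (intro mult_right_mono) (auto intro: order.strict_implies_order)
  moreover have "0 \<le> l\<^sup>2" "0 \<le> (norm \<xi>)\<^sup>2" by simp_all
  ultimately have "(norm \<xi>)\<^sup>2 \<le> 1" "l\<^sup>2 \<le> 1" using p by linarith+
  then show "p \<in> cball 0 1 \<times> cball 0 1" using p
    by (simp add: abs_square_le_1)
qed

text \<open>Fubini in the other order: for a fixed parameter \<open>(\<xi>, l)\<close> the points
  \<open>x\<close> whose region contains it form the slab
  \<open>c < x \<bullet> \<xi> \<le> 1\<close> with
  \<open>c = sqrt (l\<^sup>2 + s\<^sup>2 * (norm \<xi>)\<^sup>2)\<close>. For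
  \<open>\<xi> \<noteq> 0\<close> and \<open>c < 1\<close>, \<open>s > 1\<close> gives
  \<open>norm \<xi> < c < 1\<close>, so the slab is a difference of two half spaces that both miss
  the closed unit ball.\<close>

lemma cone_region_superposition:
  fixes \<phi> :: "'a::euclidean_space \<Rightarrow> complex"
  assumes \<phi>: "exterior_null \<Omega> \<phi>" and "open \<Omega>" and "negligible (- \<Omega>)" and "s > 1"
  shows "(LINT x|lborel. measure lborel (cone_region s x) *\<^sub>R \<phi> x) = 0"
proof -
  have rd: "rapid_decay \<phi>" using \<phi> by (simp add: exterior_null_def)
  then have [measurable]: "\<phi> \<in> borel_measurable borel" by measurable
  define B :: "('a \<times> real) set" where "B = cball 0 1 \<times> cball 0 1"
  have [measurable]: "B \<in> sets borel" unfolding B_def by (intro borel_closed closed_Times) auto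
  have "bounded B" unfolding B_def by (intro bounded_Times) auto
  then have Bfin: "emeasure lborel B < \<infinity>" by (rule emeasure_bounded_finite)
  have sub: "cone_region s x \<subseteq> B" for x :: 'a unfolding B_def by (rule cone_region_subset[OF \<open>s > 1\<close>])
  have fin: "emeasure lborel (cone_region s x) < \<infinity>" for x :: 'a
    using emeasure_mono[OF sub, of lborel x] Bfin by (auto intro: le_less_trans)
  define F where "F x p = indicator (cone_region s x) p *\<^sub>R \<phi> x" for x p
  have Fm: "case_prod F \<in> borel_measurable (lborel \<Otimes>\<^sub>M lborel)"
  proof -
    have "case_prod F = (\<lambda>q. indicator {q :: 'a \<times> 'a \<times> real. 0 < fst q \<bullet> fst (snd q) \<and> fst q \<bullet> fst (snd q) \<le> 1 \<and>
        (snd (snd q))\<^sup>2 + s\<^sup>2 * (norm (fst (snd q)))\<^sup>2 < (fst q \<bullet> fst (snd q))\<^sup>2} q *\<^sub>R \<phi> (fst q))"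
      by (auto simp: F_def cone_region_def indicator_def fun_eq_iff)
    also have "\<dots> \<in> borel_measurable (borel \<Otimes>\<^sub>M (borel \<Otimes>\<^sub>M borel))"
      by (measurable; simp add: space_pair_measure)
    finally show ?thesis by (simp add: borel_prod lborel_prod)
  qed
  have inner: "(LINT p|lborel. F x p) = measure lborel (cone_region s x) *\<^sub>R \<phi> x" for x
    unfolding F_def using fin[of x] by simp
  have Fint: "integrable (lborel \<Otimes>\<^sub>M lborel) (case_prod F)"
  proof (rule lborel_pair.Fubini_integrable[OF Fm])
    have "(\<integral>p. norm (case_prod F (x, p)) \<partial>lborel) = measure lborel (cone_region s x) * norm (\<phi> x)" for x
      unfolding F_def using fin[of x] by simp
    moreover have "(\<lambda>x. \<integral>p. norm (case_prod F (x, p)) \<partial>lborel) \<in> borel_measurable lborel"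
      using Fm by measurable
    ultimately have [measurable]: "(\<lambda>x. measure lborel (cone_region s x) * norm (\<phi> x)) \<in> borel_measurable lborel"
      by simp
    have "integrable lborel (\<lambda>x. (1 + norm x) ^ 0 *\<^sub>R \<phi> x)" using rd unfolding rapid_decay_def by blast
    then have "integrable lborel (\<lambda>x. measure lborel B * norm (\<phi> x))" by simp
    then have "integrable lborel (\<lambda>x. measure lborel (cone_region s x) * norm (\<phi> x))"
    proof (rule Bochner_Integration.integrable_bound)
      show "AE x in lborel. norm (measure lborel (cone_region s x) * norm (\<phi> x)) \<le> norm (measure lborel B * norm (\<phi> x))"
      proof (intro AE_I2)
        fix x :: 'a
        have "measure lborel (cone_region s x) \<le> measure lborel B"
          by (rule measure_mono_fmeasurable[OF sub]) (use Bfin in \<open>auto simp: fmeasurable_def\<close>)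
        then show "norm (measure lborel (cone_region s x) * norm (\<phi> x)) \<le> norm (measure lborel B * norm (\<phi> x))"
          by (simp add: mult_right_mono)
      qed
    qed measurable
    then show "integrable lborel (\<lambda>x. \<integral>p. norm (case_prod F (x, p)) \<partial>lborel)"
      unfolding F_def using fin by simp
    show "AE x in lborel. integrable lborel (\<lambda>p. case_prod F (x, p))"
      unfolding F_def using fin by (intro AE_I2) auto
  qed
  have \<Omega>: "AE p in (lborel :: ('a \<times> real) measure). fst p \<in> \<Omega>"
  proof -
    have "AE x in lborel. x \<notin> - \<Omega>"
      using \<open>open \<Omega>\<close> by (intro AE_lborel_of_negligible assms) auto
    then have "AE p in ((lborel :: 'a measure) \<Otimes>\<^sub>M (lborel :: real measure)). fst p \<in> \<Omega>"
    proof (intro lborel_pair.AE_pair_measure)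
      have [measurable]: "\<Omega> \<in> sets borel" using \<open>open \<Omega>\<close> by simp
      show "{p \<in> space (lborel \<Otimes>\<^sub>M lborel). fst p \<in> \<Omega>} \<in> sets ((lborel :: 'a measure) \<Otimes>\<^sub>M (lborel :: real measure))"
        by measurable
    qed auto
    then show ?thesis unfolding lborel_prod .
  qed
  have zero: "AE p in lborel. (LINT x|lborel. F x p) = 0"
    using \<Omega>
  proof eventually_elim
    case (elim p)
    obtain \<xi> l where p: "p = (\<xi>, l)" by (cases p)
    define c where "c = sqrt (l\<^sup>2 + s\<^sup>2 * (norm \<xi>)\<^sup>2)"
    have c2: "c\<^sup>2 = l\<^sup>2 + s\<^sup>2 * (norm \<xi>)\<^sup>2" "c \<ge> 0" by (auto simp: c_def)
    have mem: "(\<xi>, l) \<in> cone_region s x \<longleftrightarrow> c < x \<bullet> \<xi> \<and> x \<bullet> \<xi> \<le> 1" for x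
    proof -
      have "0 < t \<and> c\<^sup>2 < t\<^sup>2 \<longleftrightarrow> c < t" for t
        using c2(2) by (meson le_less_trans less_imp_le power_less_imp_less_base power_strict_mono zero_less_numeral)
      from this[of "x \<bullet> \<xi>"] show ?thesis by (auto simp: cone_region_def c2(1))
    qed
    show ?case
    \<comment> \<open>In the excluded cases the slab is empty: either its bounds cross or
      \<open>x \<bullet> \<xi> = 0\<close> cannot exceed \<open>c \<ge> 0\<close>.\<close>
    proof (cases "c < 1 \<and> \<xi> \<noteq> 0")
      case False
      then have "F x p = 0" for x using mem[of x] c2(2) by (auto simp: F_def p)
      then show ?thesis by simp
    next
      case True
      have "norm \<xi> < c"
      proof -
        have "1 * (norm \<xi>)\<^sup>2 < s\<^sup>2 * (norm \<xi>)\<^sup>2" using \<open>s > 1\<close> True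
          by (intro mult_strict_right_mono) (auto simp: one_less_power)
        then have "(norm \<xi>)\<^sup>2 < c\<^sup>2" unfolding c2 using zero_le_power2[of l] by linarith
        then show ?thesis using c2(2) power_less_imp_less_base by blast
      qed
      then have z: "(LINT x|lborel. pos_pow 0 (x \<bullet> \<xi> - c) *\<^sub>R \<phi> x) = 0" "(LINT x|lborel. pos_pow 0 (x \<bullet> \<xi> - 1) *\<^sub>R \<phi> x) = 0"
        using \<phi> elim True unfolding exterior_null_def p by auto
      have i: "integrable lborel (\<lambda>x. pos_pow 0 (x \<bullet> \<xi> - c) *\<^sub>R \<phi> x)" for c
        by (rule rapid_decay_integrable_mult[OF rd _ pos_pow_affine_growth]) measurable
      \<comment> \<open>\<open>pos_pow 0\<close> is the indicator of a strict inequality, so the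
        difference is the indicator of a slab open at \<open>c\<close> and closed at 1, exactly as
        in \<open>cone_region\<close>.\<close>
      have "F x p = pos_pow 0 (x \<bullet> \<xi> - c) *\<^sub>R \<phi> x - pos_pow 0 (x \<bullet> \<xi> - 1) *\<^sub>R \<phi> x" for x
        using mem[of x] True by (auto simp: F_def p pos_pow_def)
      then show ?thesis using i z by simp
    qed
  qed
  have "(LINT x|lborel. measure lborel (cone_region s x) *\<^sub>R \<phi> x) = (LINT x|lborel. LINT p|lborel. F x p)"
    by (simp add: inner)
  also have "\<dots> = (LINT p|lborel. LINT x|lborel. F x p)"
    by (rule lborel_pair.Fubini_integral[symmetric]) (rule Fint)
  also have "\<dots> = 0" by (rule integral_eq_zero_AE[OF zero])
  finally show ?thesis .
qed

text \<open>Rotating \<open>\<xi>\<close> along with \<open>x\<close> and leaving \<open>l\<close>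
  alone is an orthogonal map of the parameter space that carries one region to the other.\<close>

lemma measure_cone_region_orthogonal:
  fixes x y :: "'a::euclidean_space"
  assumes "norm x = norm y"
  shows "measure lborel (cone_region s x) = measure lborel (cone_region s y)"
proof -
  obtain U where U: "orthogonal_transformation U" "U y = x"
    using reflection_exists[of y x] assms by auto
  define W where "W = (\<lambda>(\<xi>, l). (U \<xi>, l :: real))"
  have lin: "linear U" using U by (simp add: orthogonal_transformation_def)
  have W: "orthogonal_transformation W"
    unfolding orthogonal_transformation_def
  proof
    show "linear W" unfolding W_def
      by (rule linearI) (auto simp: linear_add[OF lin] linear_cmul[OF lin])
    show "\<forall>v w. W v \<bullet> W w = v \<bullet> w"
      using U(1) by (auto simp: W_def orthogonal_transformation_def)
  qed
  then have [measurable]: "W \<in> borel_measurable borel"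
    by (simp add: orthogonal_transformation_def linear_continuous_on linear_conv_bounded_linear borel_measurable_continuous_onI)
  have "W -` cone_region s x = cone_region s y"
  proof -
    have "x \<bullet> U \<xi> = y \<bullet> \<xi>" "norm (U \<xi>) = norm \<xi>" for \<xi>
      using U by (auto simp: orthogonal_transformation_norm) (metis orthogonal_transformation_def)
    then show ?thesis by (auto simp: cone_region_def W_def)
  qed
  then show ?thesis
    using measure_distr[of W lborel borel "cone_region s x"] lborel_distr_orthogonal[OF W] by simp
qed

text \<open>After rotating \<open>x\<close> to \<open>r *\<^sub>R e\<close>, a diagonal map takes the fixed set \<open>D\<close> to the region,
  so the measure is the determinant times a constant.\<close>
lemma measure_cone_region:
  obtains C where "C > 0"
    "\<And>s (x::'a::euclidean_space). 1 < s \<Longrightarrow> s < norm x \<Longrightarrow> measure lborel (cone_region s x) =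
       C / (s ^ (DIM('a) - 1) * norm x ^ (DIM('a) + 1)) * sqrt ((norm x)\<^sup>2 - s\<^sup>2) ^ DIM('a)"
proof -
  obtain e :: 'a where e: "e \<in> Basis" using nonempty_Basis by blast
  \<comment> \<open>A right circular cone of height 1 and slope 1 about the axis \<open>e\<close>:
    the distance of \<open>(\<zeta>, \<mu>)\<close> from the axis is less than the height
    \<open>\<zeta> \<bullet> e\<close>.\<close>
  define D :: "('a \<times> real) set" where
    "D = {(\<zeta>, \<mu>). 0 < \<zeta> \<bullet> e \<and> \<zeta> \<bullet> e \<le> 1 \<and> \<mu>\<^sup>2 + (norm \<zeta>)\<^sup>2 - (\<zeta> \<bullet> e)\<^sup>2 < (\<zeta> \<bullet> e)\<^sup>2}"
  have Dm [measurable]: "D \<in> sets borel"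
  proof -
    have "D = {p \<in> space borel. 0 < fst p \<bullet> e \<and> fst p \<bullet> e \<le> 1 \<and> (snd p)\<^sup>2 + (norm (fst p))\<^sup>2 - (fst p \<bullet> e)\<^sup>2 < (fst p \<bullet> e)\<^sup>2}"
      by (auto simp: D_def)
    then show ?thesis by (simp add: borel_prod[symmetric])
  qed
  have "D \<subseteq> cball 0 2 \<times> cball 0 2"
  proof
    fix p assume "p \<in> D"
    then obtain \<zeta> \<mu> where p: "p = (\<zeta>, \<mu>)" "0 < \<zeta> \<bullet> e" "\<zeta> \<bullet> e \<le> 1" "\<mu>\<^sup>2 + (norm \<zeta>)\<^sup>2 - (\<zeta> \<bullet> e)\<^sup>2 < (\<zeta> \<bullet> e)\<^sup>2"
      by (auto simp: D_def)
    have "(\<zeta> \<bullet> e)\<^sup>2 \<le> 1" using p by (simp add: power_le_one)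
    moreover have "0 \<le> \<mu>\<^sup>2" "0 \<le> (norm \<zeta>)\<^sup>2" by simp_all
    ultimately have "(norm \<zeta>)\<^sup>2 \<le> 4" "\<mu>\<^sup>2 \<le> 4" using p by linarith+
    then have "(norm \<zeta>)\<^sup>2 \<le> 2\<^sup>2" "\<bar>\<mu>\<bar>\<^sup>2 \<le> 2\<^sup>2" by simp_all
    then have "norm \<zeta> \<le> 2" "\<bar>\<mu>\<bar> \<le> 2" by (meson power2_le_imp_le zero_le_numeral)+
    then show "p \<in> cball 0 2 \<times> cball 0 2" using p by simp
  qed
  moreover have "bounded (cball (0::'a) 2 \<times> cball (0::real) 2)" by (intro bounded_Times) auto
  ultimately have Dfin: "emeasure lborel D < \<infinity>"
    by (meson bounded_subset emeasure_bounded_finite)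
  have Dpos: "emeasure lborel D > 0"
  proof -
    define O' :: "('a \<times> real) set" where
      "O' = {p. 0 < fst p \<bullet> e} \<inter> {p. fst p \<bullet> e < 1} \<inter> {p. (snd p)\<^sup>2 + (norm (fst p))\<^sup>2 - (fst p \<bullet> e)\<^sup>2 < (fst p \<bullet> e)\<^sup>2}"
    have O': "open O'" unfolding O'_def
      by (intro open_Int open_Collect_less continuous_intros)
    have "norm e = 1" "e \<bullet> e = 1" using e by auto
    then have "((1/2) *\<^sub>R e, 0) \<in> O'"
      by (simp add: O'_def power_divide)
    then have "\<not> negligible O'" using O' open_not_negligible by blast
    then have "O' \<notin> null_sets lborel"
      using O' null_sets_completion_iff[of O' lborel] by (simp add: negligible_iff_null_sets)
    then have "emeasure lborel O' > 0"
      using O' by (auto simp: null_sets_def zero_less_iff_neq_zero)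
    moreover have "O' \<subseteq> D" by (auto simp: O'_def D_def)
    ultimately show ?thesis using emeasure_mono[of O' D lborel] by (auto intro: less_le_trans)
  qed
  define C where "C = measure lborel D"
  have "C > 0" using Dpos Dfin unfolding C_def measure_def by (simp add: enn2real_positive_iff)
  moreover have "measure lborel (cone_region s x) =
       C / (s ^ (DIM('a) - 1) * norm x ^ (DIM('a) + 1)) * sqrt ((norm x)\<^sup>2 - s\<^sup>2) ^ DIM('a)"
    if s: "1 < s" "s < norm x" for s and x :: 'a
  proof -
    define r where "r = norm x"
    define \<kappa> where "\<kappa> = sqrt (r\<^sup>2 - s\<^sup>2)"
    have r: "0 < s" "s < r" "0 < r" using s by (auto simp: r_def)
    then have "s\<^sup>2 < r\<^sup>2" by (simp add: power_strict_mono)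
    then have \<kappa>: "0 < \<kappa>" "\<kappa>\<^sup>2 = r\<^sup>2 - s\<^sup>2" by (auto simp: \<kappa>_def)
    \<comment> \<open>Put \<open>t = x \<bullet> \<xi>\<close>. The part of \<open>\<xi>\<close>
      along \<open>e\<close> is \<open>t / r\<close>, and the part \<open>\<eta>\<close> orthogonal
      to \<open>e\<close> satisfies \<open>l\<^sup>2 + s\<^sup>2 * (norm \<eta>)\<^sup>2 < t\<^sup>2
      * \<kappa>\<^sup>2 / r\<^sup>2\<close>. Hence the scale factors \<open>1 / r\<close> along
      \<open>e\<close>, \<open>a\<close> across it, and \<open>\<kappa> / r\<close> for
      \<open>l\<close>.\<close>
    define a where "a = \<kappa> / (s * r)"
    have a: "a > 0" using \<kappa> r by (simp add: a_def)
    define c :: "'a \<times> real \<Rightarrow> real" where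
      "c j = (if j = (e, 0) then 1 / r else if fst j = 0 then \<kappa> / r else a)" for j
    have cpos: "c j > 0" for j using r \<kappa> a by (simp add: c_def)
    define T where "T p = 0 + (\<Sum>j\<in>Basis. (c j * (p \<bullet> j)) *\<^sub>R j)" for p :: "'a \<times> real"
    have T: "T (\<zeta>, \<mu>) = (a *\<^sub>R \<zeta> + ((1 / r - a) * (\<zeta> \<bullet> e)) *\<^sub>R e, \<kappa> / r * \<mu>)" for \<zeta> \<mu>
    proof (rule euclidean_eqI)
      fix b :: "'a \<times> real" assume b: "b \<in> Basis"
      have "T (\<zeta>, \<mu>) \<bullet> b = c b * ((\<zeta>, \<mu>) \<bullet> b)"
        using b by (simp add: T_def)
      also have "\<dots> = (a *\<^sub>R \<zeta> + ((1 / r - a) * (\<zeta> \<bullet> e)) *\<^sub>R e, \<kappa> / r * \<mu>) \<bullet> b"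
      proof -
        have "c (u, 0) * (\<zeta> \<bullet> u) = a * (\<zeta> \<bullet> u) + (1 / r - a) * (\<zeta> \<bullet> e) * (e \<bullet> u)" if "u \<in> Basis" for u
          using that e nonzero_Basis[OF that] by (cases "u = e") (simp_all add: c_def inner_Basis left_diff_distrib)
        then show ?thesis
          using b by (auto simp: Basis_prod_def inner_add_left c_def[of "(0, 1)"])
      qed
      finally show "T (\<zeta>, \<mu>) \<bullet> b = (a *\<^sub>R \<zeta> + ((1 / r - a) * (\<zeta> \<bullet> e)) *\<^sub>R e, \<kappa> / r * \<mu>) \<bullet> b" .
    qed
    have det: "(\<Prod>j\<in>Basis. \<bar>c j\<bar>) = 1 / r * a ^ (DIM('a) - 1) * (\<kappa> / r)"
    proof -
      have "(\<Prod>j\<in>Basis. \<bar>c j\<bar>) = (\<Prod>j\<in>Basis. c j)" using cpos by (intro prod.cong) (auto simp: less_imp_le)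
      also have "\<dots> = (\<Prod>u\<in>Basis. c (u, 0)) * (\<Prod>v\<in>Basis. c (0, v))"
        unfolding Basis_prod_def by (subst prod.union_disjoint) (auto simp: prod.reindex inj_on_def)
      also have "(\<Prod>u\<in>Basis. c (u, 0)) = c (e, 0) * (\<Prod>u\<in>Basis - {e}. c (u, 0))"
        using e by (simp add: prod.remove)
      also have "(\<Prod>u\<in>Basis - {e}. c (u, 0)) = (\<Prod>u\<in>Basis - {e}. a)"
        by (intro prod.cong) (auto simp: c_def)
      also have "\<dots> = a ^ (DIM('a) - 1)" using e by (simp add: card_Diff_singleton)
      also have "(\<Prod>v\<in>Basis. c (0, v)) = \<kappa> / r" by (simp add: c_def)
      finally show ?thesis by (simp add: c_def)
    qed
    have pre: "T -` cone_region s (r *\<^sub>R e) = D"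
    proof -
      have "T (\<zeta>, \<mu>) \<in> cone_region s (r *\<^sub>R e) \<longleftrightarrow> (\<zeta>, \<mu>) \<in> D" for \<zeta> \<mu>
      proof -
        define t where "t = \<zeta> \<bullet> e"
        define q where "q = (1 / r - a) * t"
        define \<xi> where "\<xi> = a *\<^sub>R \<zeta> + q *\<^sub>R e"
        have ee: "e \<bullet> e = 1" "e \<bullet> \<zeta> = t" "\<zeta> \<bullet> e = t"
          using e by (simp_all add: t_def inner_commute)
        have "e \<bullet> \<xi> = a * t + q" by (simp add: \<xi>_def inner_add_right ee)
        also have "\<dots> = t / r" by (simp add: q_def left_diff_distrib)
        finally have 1: "(r *\<^sub>R e) \<bullet> \<xi> = t" using r by simp
        have "(norm \<xi>)\<^sup>2 = a * a * (\<zeta> \<bullet> \<zeta>) + 2 * a * q * t + q * q"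
          unfolding power2_norm_eq_inner \<xi>_def
          by (simp add: inner_add_right inner_add_left ee) (simp add: distrib_left mult_ac)
        also have "\<dots> = a\<^sup>2 * (norm \<zeta>)\<^sup>2 + t\<^sup>2 * (1 / r\<^sup>2 - a\<^sup>2)"
        proof -
          have "a * a * Z + 2 * a * ((p - a) * t) * t + (p - a) * t * ((p - a) * t) = a\<^sup>2 * Z + t\<^sup>2 * (p\<^sup>2 - a\<^sup>2)" for p Z
            by (simp add: power2_eq_square algebra_simps)
          from this[of "\<zeta> \<bullet> \<zeta>" "1 / r"] show ?thesis
            unfolding power2_norm_eq_inner q_def by (simp add: power_one_over)
        qed
        finally have 2: "(norm \<xi>)\<^sup>2 = a\<^sup>2 * (norm \<zeta>)\<^sup>2 + t\<^sup>2 * (1 / r\<^sup>2 - a\<^sup>2)" .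
        have "(\<kappa> / r * \<mu>)\<^sup>2 + s\<^sup>2 * (norm \<xi>)\<^sup>2 < t\<^sup>2 \<longleftrightarrow> \<mu>\<^sup>2 + (norm \<zeta>)\<^sup>2 - t\<^sup>2 < t\<^sup>2"
        proof -
          have sa: "s\<^sup>2 * a\<^sup>2 = \<kappa>\<^sup>2 / r\<^sup>2" using r by (simp add: a_def power_divide power_mult_distrib)
          have "(\<kappa> / r * \<mu>)\<^sup>2 + s\<^sup>2 * (norm \<xi>)\<^sup>2 = \<kappa>\<^sup>2 / r\<^sup>2 * \<mu>\<^sup>2 + (s\<^sup>2 * a\<^sup>2) * (norm \<zeta>)\<^sup>2 + t\<^sup>2 * (s\<^sup>2 / r\<^sup>2 - s\<^sup>2 * a\<^sup>2)"
            unfolding 2 by (simp add: power_mult_distrib power_divide algebra_simps)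
          also have "\<dots> = \<kappa>\<^sup>2 / r\<^sup>2 * (\<mu>\<^sup>2 + (norm \<zeta>)\<^sup>2 - t\<^sup>2) + t\<^sup>2 * (s\<^sup>2 / r\<^sup>2)"
            unfolding sa by (simp add: algebra_simps)
          finally have eq: "(\<kappa> / r * \<mu>)\<^sup>2 + s\<^sup>2 * (norm \<xi>)\<^sup>2 = \<kappa>\<^sup>2 / r\<^sup>2 * (\<mu>\<^sup>2 + (norm \<zeta>)\<^sup>2 - t\<^sup>2) + t\<^sup>2 * (s\<^sup>2 / r\<^sup>2)" .
          have eq2: "t\<^sup>2 = \<kappa>\<^sup>2 / r\<^sup>2 * t\<^sup>2 + t\<^sup>2 * (s\<^sup>2 / r\<^sup>2)"
          proof -
            have "\<kappa>\<^sup>2 / r\<^sup>2 + s\<^sup>2 / r\<^sup>2 = 1" using r \<kappa>(2) by (simp add: add_divide_distrib[symmetric])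
            then show ?thesis by (metis distrib_right mult.commute mult_1)
          qed
          have "\<kappa>\<^sup>2 / r\<^sup>2 > 0" using \<kappa>(1) r by simp
          then have "\<kappa>\<^sup>2 / r\<^sup>2 * (\<mu>\<^sup>2 + (norm \<zeta>)\<^sup>2 - t\<^sup>2) < \<kappa>\<^sup>2 / r\<^sup>2 * t\<^sup>2 \<longleftrightarrow> \<mu>\<^sup>2 + (norm \<zeta>)\<^sup>2 - t\<^sup>2 < t\<^sup>2"
            by (rule mult_less_cancel_left_pos)
          moreover have "L < T' \<longleftrightarrow> X < Z" if "L = X + Y" "T' = Z + Y" for L X Y Z T' :: real
            using that by simp
          note this[OF eq eq2]
          ultimately show ?thesis by (simp only:)
        qed
        moreover have "T (\<zeta>, \<mu>) = (\<xi>, \<kappa> / r * \<mu>)" by (simp only: T \<xi>_def q_def t_def)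
        moreover have "(\<xi>, l) \<in> cone_region s (r *\<^sub>R e) \<longleftrightarrow> 0 < t \<and> t \<le> 1 \<and> l\<^sup>2 + s\<^sup>2 * (norm \<xi>)\<^sup>2 < t\<^sup>2" for l
          unfolding cone_region_def by (simp only: mem_Collect_eq prod.case 1)
        moreover have "(\<zeta>, \<mu>) \<in> D \<longleftrightarrow> 0 < t \<and> t \<le> 1 \<and> \<mu>\<^sup>2 + (norm \<zeta>)\<^sup>2 - t\<^sup>2 < t\<^sup>2"
          unfolding D_def by (simp only: mem_Collect_eq prod.case t_def)
        ultimately show ?thesis by (simp only:)
      qed
      then show ?thesis by (intro set_eqI) (simp only: vimage_eq split_paired_all)
    qed
    have [measurable]: "T \<in> borel_measurable borel" unfolding T_def [abs_def] by measurable
    have "norm x = norm (r *\<^sub>R e)" using e r by (simp add: r_def)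
    then have rot: "measure lborel (cone_region s x) = measure lborel (cone_region s (r *\<^sub>R e))"
      by (rule measure_cone_region_orthogonal)
    have "emeasure lborel (cone_region s (r *\<^sub>R e)) =
        emeasure (density (distr lborel borel T) (\<lambda>_. (\<Prod>j\<in>Basis. \<bar>c j\<bar>))) (cone_region s (r *\<^sub>R e))"
      by (subst lborel_affine_euclidean[of c 0]) (use cpos in \<open>auto simp: T_def [abs_def] less_imp_neq[symmetric]\<close>)
    also have "\<dots> = ennreal (\<Prod>j\<in>Basis. \<bar>c j\<bar>) * emeasure lborel D"
      by (simp add: emeasure_density_const emeasure_distr pre)
    finally have "measure lborel (cone_region s x) = (\<Prod>j\<in>Basis. \<bar>c j\<bar>) * C"
      unfolding C_def rot by (simp add: measure_def enn2real_mult prod_nonneg)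
    also have "\<dots> = C / (s ^ (DIM('a) - 1) * r ^ (DIM('a) + 1)) * \<kappa> ^ DIM('a)"
    proof -
      obtain d where d: "DIM('a) = Suc d" using DIM_positive[where 'a='a] gr0_implies_Suc by blast
      show ?thesis unfolding det d a_def using r
        by (simp add: power_divide power_mult_distrib field_simps)
    qed
    finally show ?thesis by (simp add: r_def \<kappa>_def)
  qed
  ultimately show ?thesis using that by blast
qed

section \<open>From the cone kernel to exteriors of balls and annuli\<close>

lemma cone_region_eq_empty:
  assumes "norm x \<le> s" "s > 1"
  shows "cone_region s (x::'a::euclidean_space) = {}"
proof -
  have False if "0 < x \<bullet> \<xi>" "l\<^sup>2 + s\<^sup>2 * (norm \<xi>)\<^sup>2 < (x \<bullet> \<xi>)\<^sup>2" for \<xi> and l :: real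
  proof -
    have "x \<bullet> \<xi> \<le> norm x * norm \<xi>" by (rule norm_cauchy_schwarz)
    also have "\<dots> \<le> s * norm \<xi>" using assms by (intro mult_right_mono) auto
    finally have "(x \<bullet> \<xi>)\<^sup>2 \<le> (s * norm \<xi>)\<^sup>2" using that by (intro power_mono) auto
    then show False using that zero_le_power2[of l] unfolding power_mult_distrib by linarith
  qed
  then show ?thesis by (auto simp: cone_region_def)
qed

text \<open>The measure of the superposition region is the kernel \<open>(|x|\<^sup>2 - s\<^sup>2)\<^sub>+\<^sup>m |x|\<^sup>-\<^sup>2\<^sup>m\<^sup>-\<^sup>1\<close>
  up to a positive factor, and differentiating it \<open>m\<close> times in \<open>s\<^sup>2\<close> leaves an indicator.\<close>
lemma exterior_null_integral_outside_ball:
  fixes \<phi> :: "'a::euclidean_space \<Rightarrow> complex"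
  assumes \<phi>: "exterior_null \<Omega> \<phi>" and "open \<Omega>" and "negligible (- \<Omega>)"
    and dim: "DIM('a) = 2 * m" and "\<sigma> > 1"
  shows "(LINT x|lborel. (pos_pow 0 ((norm x)\<^sup>2 - \<sigma>) / norm x ^ (2 * m + 1)) *\<^sub>R \<phi> x) = 0"
proof -
  have rd: "rapid_decay \<phi>" using \<phi> by (simp add: exterior_null_def)
  \<comment> \<open>The singular factor of the kernel is cut off inside the unit ball, where none of
    the integrands with \<open>\<sigma> > 1\<close> sees it. This makes \<open>\<psi>\<close>
    rapidly decaying and independent of \<open>\<sigma>\<close>.\<close>
  define w where "w x = indicator {x. 1 < norm x} x / norm x ^ (2 * m + 1)" for x :: 'a
  have [measurable]: "w \<in> borel_measurable borel" unfolding w_def by measurable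
  have wb: "\<bar>w x\<bar> \<le> 1 * (1 + norm x) ^ 0" for x
    by (auto simp: w_def indicator_def divide_le_eq_1 one_le_power simp del: power_Suc)
  define \<psi> where "\<psi> x = w x *\<^sub>R \<phi> x" for x
  have rd\<psi>: "rapid_decay \<psi>" unfolding \<psi>_def [abs_def] by (rule rapid_decay_mult[OF rd _ wb]) measurable
  then have [measurable]: "\<psi> \<in> borel_measurable borel" by measurable
  have top: "(LINT x|lborel. pos_pow m ((norm x)\<^sup>2 - \<sigma>) *\<^sub>R \<psi> x) = 0" if "\<sigma> > 1" for \<sigma>
  proof -
    obtain C where C: "C > 0" "\<And>s (x::'a). 1 < s \<Longrightarrow> s < norm x \<Longrightarrow> measure lborel (cone_region s x) =
       C / (s ^ (DIM('a) - 1) * norm x ^ (DIM('a) + 1)) * sqrt ((norm x)\<^sup>2 - s\<^sup>2) ^ DIM('a)"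
      using measure_cone_region by blast
    define s where "s = sqrt \<sigma>"
    have s: "s > 1" "s\<^sup>2 = \<sigma>" using that by (auto simp: s_def)
    \<comment> \<open>The power of \<open>s\<close> in the cone volume does not depend on
      \<open>x\<close>. It is split off here and cancelled before any derivative in
      \<open>\<sigma>\<close> is taken.\<close>
    have "measure lborel (cone_region s x) *\<^sub>R \<phi> x = (C / s ^ (2 * m - 1)) *\<^sub>R (pos_pow m ((norm x)\<^sup>2 - \<sigma>) *\<^sub>R \<psi> x)" for x
    proof (cases "norm x \<le> s")
      case True
      then have "(norm x)\<^sup>2 \<le> s\<^sup>2" by (intro power_mono) auto
      then show ?thesis using cone_region_eq_empty[OF True s(1)] s by (simp add: pos_pow_def)
    next
      case False
      then have x: "s < norm x" by simp
      then have sq: "s\<^sup>2 < (norm x)\<^sup>2" using s by (intro power_strict_mono) auto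
      have "sqrt ((norm x)\<^sup>2 - s\<^sup>2) ^ (2 * m) = ((norm x)\<^sup>2 - s\<^sup>2) ^ m"
        using sq by (simp add: power_mult)
      then have "measure lborel (cone_region s x) = (C / s ^ (2 * m - 1)) * (pos_pow m ((norm x)\<^sup>2 - \<sigma>) * w x)"
        unfolding C(2)[OF s(1) x] dim using sq s x by (simp add: pos_pow_def w_def)
      then show ?thesis by (simp add: \<psi>_def)
    qed
    then have "(C / s ^ (2 * m - 1)) *\<^sub>R (LINT x|lborel. pos_pow m ((norm x)\<^sup>2 - \<sigma>) *\<^sub>R \<psi> x) = 0"
      using cone_region_superposition[OF \<phi> assms(2,3) s(1)]
      unfolding integral_scaleR_right[symmetric] by (simp only:)
    then show ?thesis using C(1) s by auto
  qed
  \<comment> \<open>One derivative in \<open>\<sigma>\<close>: increasing \<open>\<sigma>\<close> by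
    \<open>\<tau>\<close> changes the argument by \<open>- \<tau>\<close>, hence the direction
    \<open>\<beta> = - 1\<close>. Increasing \<open>\<sigma>\<close> preserves
    \<open>\<sigma> > 1\<close>, and the kink set is a sphere of measure zero.\<close>
  have step: "(LINT x|lborel. pos_pow j ((norm x)\<^sup>2 - \<sigma>) *\<^sub>R \<psi> x) = 0"
    if Suc_j: "\<And>\<sigma>. \<sigma> > 1 \<Longrightarrow> (LINT x|lborel. pos_pow (Suc j) ((norm x)\<^sup>2 - \<sigma>) *\<^sub>R \<psi> x) = 0" and "\<sigma> > 1" for j \<sigma>
  proof -
    have "(LINT x|lborel. pos_pow j ((norm x)\<^sup>2 - \<sigma>) *\<^sub>R ((- 1) *\<^sub>R \<psi> x)) = 0"
    proof (rule integral_pos_pow_derivative_zero[where \<epsilon>=1])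
      show "integrable lborel (\<lambda>x. (1 + \<bar>(norm x)\<^sup>2 - \<sigma>\<bar> + \<bar>- 1\<bar>) ^ Suc j *\<^sub>R \<psi> x)"
      proof (rule rapid_decay_integrable_mult[OF rd\<psi>])
        fix x :: 'a
        have "1 + \<bar>(norm x)\<^sup>2 - \<sigma>\<bar> + \<bar>- 1\<bar> \<le> (2 + \<sigma>) * (1 + norm x)\<^sup>2"
        proof -
          have "0 \<le> \<sigma> * norm x" "0 \<le> \<sigma> * (norm x)\<^sup>2" using that by auto
          then show ?thesis using that by (simp add: power2_eq_square algebra_simps abs_if)
        qed
        then have "(1 + \<bar>(norm x)\<^sup>2 - \<sigma>\<bar> + \<bar>- 1\<bar>) ^ Suc j \<le> ((2 + \<sigma>) * (1 + norm x)\<^sup>2) ^ Suc j"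
          by (intro power_mono) auto
        also have "\<dots> = (2 + \<sigma>) ^ Suc j * (1 + norm x) ^ (2 * Suc j)"
          by (simp only: power_mult_distrib power_mult)
        finally show "\<bar>(1 + \<bar>(norm x)\<^sup>2 - \<sigma>\<bar> + \<bar>- 1\<bar>) ^ Suc j\<bar> \<le> (2 + \<sigma>) ^ Suc j * (1 + norm x) ^ (2 * Suc j)"
          by (simp only: power_abs)
      qed measurable
      show "(LINT x|lborel. pos_pow (Suc j) ((norm x)\<^sup>2 - \<sigma> + \<tau> * - 1) *\<^sub>R \<psi> x) = 0" if "0 \<le> \<tau>" for \<tau>
        using Suc_j[of "\<sigma> + \<tau>"] that \<open>\<sigma> > 1\<close> by (simp add: algebra_simps)
      have "AE x in lborel. x \<notin> sphere (0::'a) (sqrt \<sigma>)"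
        by (intro AE_lborel_of_negligible negligible_sphere) auto
      then show "AE x in lborel. (norm (x::'a))\<^sup>2 - \<sigma> \<noteq> 0"
        by eventually_elim auto
    qed auto
    then show ?thesis by simp
  qed
  have "(LINT x|lborel. pos_pow (m - i) ((norm x)\<^sup>2 - \<sigma>) *\<^sub>R \<psi> x) = 0" if "i \<le> m" "\<sigma> > 1" for i \<sigma>
    using that
  proof (induction i arbitrary: \<sigma>)
    case (Suc i)
    then have eq: "Suc (m - Suc i) = m - i" by simp
    show ?case
      by (rule step; (unfold eq)?) (use Suc in simp_all)
  qed (use top in simp)
  from this[of m \<sigma>] have "(LINT x|lborel. pos_pow 0 ((norm x)\<^sup>2 - \<sigma>) *\<^sub>R \<psi> x) = 0"
    using \<open>\<sigma> > 1\<close> by simp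
  moreover have "pos_pow 0 ((norm x)\<^sup>2 - \<sigma>) *\<^sub>R \<psi> x = (pos_pow 0 ((norm x)\<^sup>2 - \<sigma>) / norm x ^ (2 * m + 1)) *\<^sub>R \<phi> x" for x
  proof (cases "(norm x)\<^sup>2 > \<sigma>")
    case True
    then have "1 < norm x" using \<open>\<sigma> > 1\<close> by (metis less_trans not_less norm_ge_zero power_le_one)
    then show ?thesis using True by (simp add: \<psi>_def w_def pos_pow_def)
  qed (simp add: pos_pow_def)
  ultimately show ?thesis by simp
qed

text \<open>On an annulus around the sphere through \<open>x0\<close>, \<open>\<phi>\<close> is
  orthogonal to all polynomials for a positive weight. Approximating \<open>cnj \<phi>\<close>
  uniformly by polynomials there forces the weighted integral of
  \<open>(norm (\<phi> x))\<^sup>2\<close> to vanish, and continuity turns almost everywhere into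
  everywhere.\<close>

lemma exterior_null_imp_zero:
  fixes \<phi> :: "'a::euclidean_space \<Rightarrow> complex"
  assumes \<phi>: "exterior_null \<Omega> \<phi>" and "open \<Omega>" and "negligible (- \<Omega>)"
    and dim: "DIM('a) = 2 * m" and cont: "continuous_on UNIV \<phi>" and x0: "norm x0 > 1"
  shows "\<phi> x0 = 0"
proof -
  have rd: "rapid_decay \<phi>" using \<phi> by (simp add: exterior_null_def)
  then have [measurable]: "\<phi> \<in> borel_measurable borel" by measurable
  obtain s where s: "1 < s" "s < norm x0" using x0 dense by blast
  define R where "R = norm x0 + 1"
  have sR: "s\<^sup>2 < R\<^sup>2" "1 < s\<^sup>2" "1 < R\<^sup>2" "0 < R" using s by (auto simp: R_def intro!: power_strict_mono one_less_power)
  \<comment> \<open>The difference of the kernels for two radii. It is positive for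
    \<open>s < norm x < R\<close> and zero for \<open>norm x > R\<close>; this bounded support is
    what lets a uniform approximation on \<open>cball 0 R\<close> control the integral.\<close>
  define w where "w x = (pos_pow 0 ((norm x)\<^sup>2 - s\<^sup>2) - pos_pow 0 ((norm x)\<^sup>2 - R\<^sup>2)) / norm x ^ (2 * m + 1)" for x :: 'a
  have [measurable]: "w \<in> borel_measurable borel" unfolding w_def by measurable
  have w0: "w x \<ge> 0" for x using sR by (auto simp: w_def pos_pow_def)
  have wpos: "w x > 0" if "s < norm x" "norm x < R" for x
  proof -
    have "s\<^sup>2 < (norm x)\<^sup>2" "(norm x)\<^sup>2 < R\<^sup>2" "0 < norm x" using that s by (auto intro!: power_strict_mono)
    then show ?thesis by (simp add: w_def pos_pow_def)
  qed
  have wout: "w x = 0" if "norm x > R" for x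
  proof -
    have "R\<^sup>2 < (norm x)\<^sup>2" using that sR by (intro power_strict_mono) auto
    then show ?thesis using sR by (simp add: w_def pos_pow_def)
  qed
  have pb: "\<bar>pos_pow 0 ((norm x)\<^sup>2 - t) / norm x ^ (2 * m + 1)\<bar> \<le> 1 * (1 + norm x) ^ 0" if "1 < t" for t and x :: 'a
  proof (cases "(norm x)\<^sup>2 > t")
    case True
    then have "1 < norm x" using that by (metis less_trans not_less norm_ge_zero power_le_one)
    then have "1 \<le> norm x ^ (2 * m + 1)" by (intro one_le_power) auto
    then show ?thesis using True by (simp add: pos_pow_def divide_le_eq_1 del: power_Suc)
  qed (simp add: pos_pow_def)
  have wb: "\<bar>w x\<bar> \<le> 2 * (1 + norm x) ^ 0" for x
    using pb[OF sR(2), of x] pb[OF sR(3), of x] unfolding w_def diff_divide_distrib by linarith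
  have zero_real: "integrable lborel (\<lambda>x. w x *\<^sub>R (p x *\<^sub>R \<phi> x)) \<and> (LINT x|lborel. w x *\<^sub>R (p x *\<^sub>R \<phi> x)) = 0"
    if p: "real_polynomial_function p" for p
  proof -
    have E: "exterior_null \<Omega> (\<lambda>x. p x *\<^sub>R \<phi> x)" by (rule exterior_null_mult_polynomial[OF p \<open>open \<Omega>\<close> \<phi>])
    then have rp: "rapid_decay (\<lambda>x. p x *\<^sub>R \<phi> x)" by (simp add: exterior_null_def)
    have i: "integrable lborel (\<lambda>x. (pos_pow 0 ((norm x)\<^sup>2 - t) / norm x ^ (2 * m + 1)) *\<^sub>R (p x *\<^sub>R \<phi> x))" if "1 < t" for t
      by (rule rapid_decay_integrable_mult[OF rp _ pb[OF that]]) measurable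
    note z = exterior_null_integral_outside_ball[OF E assms(2,3) dim]
    show ?thesis
      unfolding w_def diff_divide_distrib scaleR_diff_left
      using i[OF sR(2)] i[OF sR(3)] z[OF sR(2)] z[OF sR(3)] by simp
  qed
  have zero: "integrable lborel (\<lambda>x. w x *\<^sub>R (g x * \<phi> x)) \<and> (LINT x|lborel. w x *\<^sub>R (g x * \<phi> x)) = 0"
    if g: "polynomial_function g" for g :: "'a \<Rightarrow> complex"
  proof -
    \<comment> \<open>The approximating polynomials are complex valued, while the vanishing is known
      for real multipliers; real and imaginary part are treated separately.\<close>
    have "real_polynomial_function (\<lambda>x. Re (g x))" "real_polynomial_function (\<lambda>x. Im (g x))"
      using g bounded_linear_Re bounded_linear_Im unfolding polynomial_function_def comp_def by blast+
    note z = zero_real[OF this(1)] zero_real[OF this(2)]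
    define A where "A x = w x *\<^sub>R (Re (g x) *\<^sub>R \<phi> x)" for x
    define A' where "A' x = w x *\<^sub>R (Im (g x) *\<^sub>R \<phi> x)" for x
    have "integrable lborel A" "integrable lborel A'" "(LINT x|lborel. A x) = 0" "(LINT x|lborel. A' x) = 0"
      using z by (auto simp only: A_def [abs_def] A'_def [abs_def])
    moreover have "w x *\<^sub>R (g x * \<phi> x) = A x + \<i> * A' x" for x
      unfolding A_def A'_def by (subst complex_eq[of "g x"]) (simp add: scaleR_conv_of_real algebra_simps)
    ultimately show ?thesis by simp
  qed
  have bdd: "bounded (\<phi> ` cball 0 R)"
    using cont by (intro compact_imp_bounded compact_continuous_image) (auto intro: continuous_on_subset)
  define I where "I = (LINT x|lborel. w x * norm (\<phi> x))"
  have int1: "integrable lborel (\<lambda>x. w x * norm (\<phi> x))"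
  proof -
    have "integrable lborel (\<lambda>x. norm (w x *\<^sub>R \<phi> x))"
      by (rule integrable_norm, rule rapid_decay_integrable_mult[OF rd _ wb]) measurable
    then show ?thesis using w0 by simp
  qed
  obtain B where B: "\<And>x. x \<in> cball 0 R \<Longrightarrow> norm (\<phi> x) \<le> B" using bdd unfolding bounded_iff by blast
  have [measurable]: "(\<lambda>x. cnj (\<phi> x)) \<in> borel_measurable borel"
    by (intro borel_measurable_continuous_onI continuous_intros cont)
  have int2: "integrable lborel (\<lambda>x. w x *\<^sub>R (cnj (\<phi> x) * \<phi> x))"
  proof (rule Bochner_Integration.integrable_bound)
    show "integrable lborel (\<lambda>x. B * (w x * norm (\<phi> x)))" using int1 by simp
    show "AE x in lborel. norm (w x *\<^sub>R (cnj (\<phi> x) * \<phi> x)) \<le> norm (B * (w x * norm (\<phi> x)))"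
    proof (intro AE_I2)
      fix x
      show "norm (w x *\<^sub>R (cnj (\<phi> x) * \<phi> x)) \<le> norm (B * (w x * norm (\<phi> x)))"
      proof (cases "norm x > R")
        case False
        then have "norm (\<phi> x) \<le> \<bar>B\<bar>" using B[of x] by auto
        then have "norm (\<phi> x) * (w x * norm (\<phi> x)) \<le> \<bar>B\<bar> * (w x * norm (\<phi> x))"
          using w0 by (intro mult_right_mono) auto
        then show ?thesis using w0[of x] by (simp add: norm_mult abs_mult mult_ac)
      qed (simp add: wout)
    qed
  qed measurable
  have small: "norm (LINT x|lborel. w x *\<^sub>R (cnj (\<phi> x) * \<phi> x)) \<le> \<epsilon> * I" if \<epsilon>: "\<epsilon> > 0" for \<epsilon>
  proof -
    have "continuous_on (cball 0 R) (\<lambda>x. cnj (\<phi> x))"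
      using cont by (intro continuous_intros) (auto intro: continuous_on_subset)
    then have "\<exists>g. polynomial_function g \<and> (\<forall>x\<in>cball 0 R. norm (cnj (\<phi> x) - g x) < \<epsilon>)"
      by (rule Stone_Weierstrass_polynomial_function[OF compact_cball _ \<epsilon>])
    then obtain g :: "'a \<Rightarrow> complex"
      where g: "polynomial_function g" "\<And>x. x \<in> cball 0 R \<Longrightarrow> norm (cnj (\<phi> x) - g x) < \<epsilon>"
      by auto
    have "(LINT x|lborel. w x *\<^sub>R (cnj (\<phi> x) * \<phi> x)) = (LINT x|lborel. w x *\<^sub>R (cnj (\<phi> x) * \<phi> x) - w x *\<^sub>R (g x * \<phi> x))"
      using zero[OF g(1)] int2 by simp
    also have "norm \<dots> \<le> (LINT x|lborel. \<epsilon> * (w x * norm (\<phi> x)))"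
    proof (rule Bochner_Integration.integral_norm_bound_integral)
      show "integrable lborel (\<lambda>x. w x *\<^sub>R (cnj (\<phi> x) * \<phi> x) - w x *\<^sub>R (g x * \<phi> x))"
        using zero[OF g(1)] int2 by simp
      show "integrable lborel (\<lambda>x. \<epsilon> * (w x * norm (\<phi> x)))" using int1 by simp
      fix x
      show "norm (w x *\<^sub>R (cnj (\<phi> x) * \<phi> x) - w x *\<^sub>R (g x * \<phi> x)) \<le> \<epsilon> * (w x * norm (\<phi> x))"
      proof (cases "norm x > R")
        case False
        have "w x *\<^sub>R (cnj (\<phi> x) * \<phi> x) - w x *\<^sub>R (g x * \<phi> x) = w x *\<^sub>R ((cnj (\<phi> x) - g x) * \<phi> x)"
          by (simp add: algebra_simps)
        also have "norm \<dots> = norm (cnj (\<phi> x) - g x) * (w x * norm (\<phi> x))"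
          using w0[of x] by (simp add: norm_mult)
        also have "\<dots> \<le> \<epsilon> * (w x * norm (\<phi> x))"
          using w0[of x] g(2)[of x] False by (intro mult_right_mono) auto
        finally show ?thesis .
      qed (simp add: wout)
    qed
    also have "\<dots> = \<epsilon> * I" by (simp add: I_def)
    finally show ?thesis .
  qed
  have I0: "I \<ge> 0" unfolding I_def using w0 by (intro Bochner_Integration.integral_nonneg) auto
  have "norm (LINT x|lborel. w x *\<^sub>R (cnj (\<phi> x) * \<phi> x)) \<le> 0 + \<delta>" if "\<delta> > 0" for \<delta>
  proof -
    \<comment> \<open>The tolerance \<open>\<delta> / (I + 1)\<close> is chosen so that no case
      \<open>I = 0\<close> has to be split off.\<close>
    have "\<delta> * (I / (I + 1)) \<le> \<delta> * 1" using that I0 by (intro mult_left_mono) auto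
    then have "\<delta> / (I + 1) * I \<le> \<delta>" by simp
    then show ?thesis using small[of "\<delta> / (I + 1)"] that I0 by simp
  qed
  then have "norm (LINT x|lborel. w x *\<^sub>R (cnj (\<phi> x) * \<phi> x)) \<le> 0" by (rule field_le_epsilon)
  then have J: "(LINT x|lborel. w x *\<^sub>R (cnj (\<phi> x) * \<phi> x)) = 0" by (simp only: norm_le_zero_iff)
  have sq: "w x *\<^sub>R (cnj (\<phi> x) * \<phi> x) = of_real (w x * (norm (\<phi> x))\<^sup>2)" for x
    unfolding of_real_mult complex_norm_square scaleR_conv_of_real by (simp only: mult_ac)
  have z: "(LINT x|lborel. w x * (norm (\<phi> x))\<^sup>2) = 0"
    using J unfolding sq integral_complex_of_real by (simp only: of_real_eq_0_iff)
  have "integrable lborel (\<lambda>x. w x * (norm (\<phi> x))\<^sup>2)"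
    using int2 unfolding sq complex_of_real_integrable_eq .
  then have "AE x in lborel. w x * (norm (\<phi> x))\<^sup>2 = 0"
    using z w0 by (subst (asm) integral_nonneg_eq_0_iff_AE) auto
  then have ae: "AE x in lborel. x \<notin> {x. s < norm x} \<inter> {x. norm x < R} \<inter> {x. \<phi> x \<noteq> 0}" (is "AE x in _. x \<notin> ?N")
  proof eventually_elim
    case (elim x)
    then show ?case using wpos[of x] by auto
  qed
  \<comment> \<open>The points of the open annulus where \<open>\<phi>\<close> is nonzero form an
    open null set, hence the empty set.\<close>
  have "open {x. \<phi> x \<noteq> 0}"
    using cont by (intro open_Collect_neq) auto
  then have opN: "open ?N" by (intro open_Int open_Collect_less continuous_intros)
  then have "?N \<in> null_sets lborel" using ae by (simp add: AE_iff_null_sets)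
  then have "negligible ?N" by (simp add: negligible_iff_null_sets null_sets_completionI)
  then have "?N = {}" using opN open_not_negligible by blast
  moreover have "s < norm x0" "norm x0 < R" using s by (auto simp: R_def)
  ultimately show ?thesis by blast
qed

section \<open>The cone transform and half space integrals\<close>

lemma schwartz_continuous:
  assumes "schwartz f" shows "continuous_on UNIV f"
proof -
  have "iter_partial [] f differentiable (at x)" for x
    using assms unfolding schwartz_def by (metis empty_subsetI list.set(1))
  then show ?thesis
    by (intro continuous_at_imp_continuous_on ballI) (auto intro: differentiable_imp_continuous_within)
qed

lemma schwartz_bounded:
  assumes "schwartz f" shows "bounded (range (\<lambda>x. norm x ^ k *\<^sub>R f x))"
proof -
  have "bounded (range (\<lambda>x. norm x ^ k *\<^sub>R iter_partial [] f x))"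
    using assms unfolding schwartz_def by (metis empty_subsetI list.set(1))
  then show ?thesis by simp
qed

lemma schwartz_rapid_decay: "schwartz f \<Longrightarrow> rapid_decay f"
  by (intro rapid_decayI schwartz_continuous schwartz_bounded)

text \<open>Along the slice the argument of \<open>f\<close> has norm at least
  \<open>norm y\<close>, so the decay of \<open>f\<close> on the product space passes to the
  slice.\<close>

lemma schwartz_slice_integrable:
  fixes f :: "'a::euclidean_space \<times> 'a \<Rightarrow> complex"
  assumes f: "schwartz f"
  shows "integrable lborel (\<lambda>y. f (u + s *\<^sub>R y, y))"
proof -
  have "rapid_decay (\<lambda>y. f (u + s *\<^sub>R y, y))"
  proof (rule rapid_decayI)
    show "continuous_on UNIV (\<lambda>y. f (u + s *\<^sub>R y, y))"
      by (rule continuous_on_compose2[OF schwartz_continuous[OF f]]) (auto intro!: continuous_intros)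
    fix k
    obtain B where B: "\<And>p. norm (norm p ^ k *\<^sub>R f p) \<le> B"
      using schwartz_bounded[OF f, of k] unfolding bounded_iff by blast
    have "norm (norm y ^ k *\<^sub>R f (u + s *\<^sub>R y, y)) \<le> B" for y
    proof -
      have "norm y ^ k \<le> norm (u + s *\<^sub>R y, y) ^ k"
        by (intro power_mono norm_snd_le norm_ge_zero)
      then have "norm (norm y ^ k *\<^sub>R f (u + s *\<^sub>R y, y)) \<le> norm (norm (u + s *\<^sub>R y, y) ^ k *\<^sub>R f (u + s *\<^sub>R y, y))"
        by (auto intro!: mult_right_mono)
      then show ?thesis using B order_trans by blast
    qed
    then show "bounded (range (\<lambda>y. norm y ^ k *\<^sub>R f (u + s *\<^sub>R y, y)))"
      unfolding bounded_iff by blast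
  qed
  then have "integrable lborel (\<lambda>y. (1 + norm y) ^ 0 *\<^sub>R f (u + s *\<^sub>R y, y))"
    unfolding rapid_decay_def by blast
  then show ?thesis by simp
qed

text \<open>A hyperplane in the product space with normal \<open>(a, b)\<close>, \<open>a \<noteq> 0\<close>, is fibred by the
  planes \<open>{(u + s y, y)}\<close> over which the cone transform integrates, once the second component has
  been rotated so that \<open>b = - s a\<close>.\<close>
lemma cone_transform_exterior_null:
  fixes f :: "(real ^ 'm) \<times> (real ^ 'm) \<Rightarrow> complex"
  assumes f: "f \<in> schwartz_radial"
    and zero: "\<And>u v. norm u > sqrt (1 + (norm v)\<^sup>2) \<Longrightarrow> cone_transform f u v = 0"
  shows "exterior_null {\<xi>. fst \<xi> \<noteq> 0} f"
  unfolding exterior_null_def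
proof (intro conjI allI ballI impI)
  have schw: "schwartz f" and rad: "\<And>U x y. orthogonal_transformation U \<Longrightarrow> f (x, y) = f (x, U y)"
    using f unfolding schwartz_radial_def by blast+
  show rd: "rapid_decay f" by (rule schwartz_rapid_decay[OF schw])
  then have [measurable]: "f \<in> borel_measurable borel" by measurable
  fix k c and \<xi> :: "(real ^ 'm) \<times> (real ^ 'm)"
  assume "\<xi> \<in> {\<xi>. fst \<xi> \<noteq> 0}" and c: "norm \<xi> < c"
  then obtain a b where \<xi>: "\<xi> = (a, b)" "a \<noteq> 0" by (cases \<xi>) auto
  define F where "F p = pos_pow k (p \<bullet> \<xi> - c) *\<^sub>R f p" for p
  have [measurable]: "F \<in> borel_measurable borel" unfolding F_def [abs_def] by measurable
  have Fint: "integrable lborel F" unfolding F_def [abs_def]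
    by (rule rapid_decay_integrable_mult[OF rd _ pos_pow_affine_growth]) measurable
  define s where "s = norm b / norm a"
  have s: "s \<ge> 0" by (simp add: s_def)
  \<comment> \<open>With \<open>U\<close> taking \<open>- s *\<^sub>R a\<close> to \<open>b\<close>,
    the inner product of \<open>U y\<close> with \<open>b\<close> is
    \<open>- s * (y \<bullet> a)\<close>. It cancels the term that the shear adds, so the half space
    condition involves \<open>u\<close> alone, while radiality removes \<open>U\<close> from
    \<open>f\<close>.\<close>
  have "norm ((- s) *\<^sub>R a) = norm b" using \<xi> by (simp add: s_def)
  then obtain U where U: "orthogonal_transformation U" "U ((- s) *\<^sub>R a) = b"
    by (rule reflection_exists)
  define W where "W = (\<lambda>(x :: real ^ 'm, y :: real ^ 'm). (x, U y))"
  define S where "S = (\<lambda>(x :: real ^ 'm, y :: real ^ 'm). (x + s *\<^sub>R y, y))"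
  have lin: "linear U" using U by (simp add: orthogonal_transformation_def)
  have W: "orthogonal_transformation W"
    unfolding orthogonal_transformation_def
  proof
    show "linear W" unfolding W_def
      by (rule linearI) (auto simp: linear_add[OF lin] linear_cmul[OF lin])
    show "\<forall>v w. W v \<bullet> W w = v \<bullet> w"
      using U(1) by (auto simp: W_def orthogonal_transformation_def)
  qed
  then have [measurable]: "W \<in> borel_measurable borel"
    by (simp add: orthogonal_transformation_def linear_continuous_on linear_conv_bounded_linear borel_measurable_continuous_onI)
  have [measurable]: "S \<in> borel_measurable borel" unfolding S_def by (simp add: borel_prod[symmetric])
  have WS: "distr lborel borel (\<lambda>p. W (S p)) = lborel"
  proof -
    have "distr lborel borel (\<lambda>p. W (S p)) = distr (distr lborel borel S) borel W"
      by (simp add: distr_distr comp_def)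
    then show ?thesis
      unfolding S_def by (simp only: lborel_distr_shear lborel_distr_orthogonal[OF W])
  qed
  have FWS: "F (W (S (u, y))) = pos_pow k (u \<bullet> a - c) *\<^sub>R f (u + s *\<^sub>R y, y)" for u y
  proof -
    have "U y \<bullet> b = y \<bullet> ((- s) *\<^sub>R a)"
      using U(1) unfolding U(2)[symmetric] orthogonal_transformation_def by blast
    then have "(u + s *\<^sub>R y, U y) \<bullet> \<xi> = u \<bullet> a"
      by (simp add: \<xi> inner_add_left)
    then show ?thesis using rad[OF U(1), of "u + s *\<^sub>R y" y]
      by (simp add: F_def W_def S_def)
  qed
  \<comment> \<open>Any vector of norm \<open>s\<close> would do, since the cone transform sees
    \<open>v\<close> only through its norm.\<close>
  define v where "v = (s / norm a) *\<^sub>R a"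
  have v: "norm v = s" using s \<xi> by (simp add: v_def)
  have "integral\<^sup>L lborel F = (LINT p|lborel. F (W (S p)))"
    by (subst WS[symmetric], rule integral_distr) measurable
  also have "\<dots> = (LINT u|lborel. LINT y|lborel. F (W (S (u, y))))"
  proof -
    have "integrable lborel (\<lambda>p. F (W (S p)))"
      using Fint by (subst (asm) WS[symmetric], subst (asm) integrable_distr_eq) auto
    then show ?thesis
      using lborel_pair.integral_fst'[of "\<lambda>p. F (W (S p))"] by (simp add: lborel_prod)
  qed
  also have "\<dots> = (LINT u|lborel. pos_pow k (u \<bullet> a - c) *\<^sub>R cone_transform f u v)"
    by (simp add: FWS cone_transform_def v)
  also have "\<dots> = (LINT u|(lborel :: (real ^ 'm) measure). 0)"
  proof (rule Bochner_Integration.integral_cong[OF refl])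
    fix u
    show "pos_pow k (u \<bullet> a - c) *\<^sub>R cone_transform f u v = 0"
    proof (cases "u \<bullet> a > c")
      case True
      \<comment> \<open>This identity matches the two exterior conditions:
        \<open>u \<bullet> a > c > norm \<xi>\<close> forces
        \<open>norm u > sqrt (1 + s\<^sup>2)\<close>, the region where the transform is known to
        vanish.\<close>
      have "norm \<xi> = norm a * sqrt (1 + s\<^sup>2)"
      proof -
        have b: "norm b = norm a * s" using \<xi> by (simp add: s_def)
        have "norm \<xi> = sqrt ((norm a)\<^sup>2 * (1 + s\<^sup>2))"
          by (simp add: \<xi>(1) norm_Pair b power_mult_distrib distrib_left mult.commute)
        then show ?thesis by (simp add: real_sqrt_mult)
      qed
      moreover have "u \<bullet> a \<le> norm a * norm u" using norm_cauchy_schwarz[of u a] by (simp add: mult.commute)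
      ultimately have "norm a * sqrt (1 + s\<^sup>2) < norm a * norm u" using True c by linarith
      then have "sqrt (1 + s\<^sup>2) < norm u" using \<xi> by simp
      then show ?thesis using zero[of v u] v by simp
    qed (simp add: pos_pow_def)
  qed
  finally show "(LINT x|lborel. pos_pow k (x \<bullet> \<xi> - c) *\<^sub>R f x) = 0" by (simp add: F_def [abs_def])
qed

lemma cone_transform_support:
  fixes f :: "(real ^ 'm) \<times> (real ^ 'm) \<Rightarrow> complex"
  assumes f: "f \<in> schwartz_radial"
    and zero: "\<And>u v. norm u > sqrt (1 + (norm v)\<^sup>2) \<Longrightarrow> cone_transform f u v = 0"
    and xy: "(norm x)\<^sup>2 + (norm y)\<^sup>2 > 1"
  shows "f (x, y) = 0"
proof (rule exterior_null_imp_zero[where \<phi>=f and \<Omega>="{\<xi>. fst \<xi> \<noteq> 0}" and m="CARD('m)"])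
  let ?\<Omega> = "{\<xi> :: (real ^ 'm) \<times> (real ^ 'm). fst \<xi> \<noteq> 0}"
  show "exterior_null ?\<Omega> f" by (rule cone_transform_exterior_null[OF f zero])
  show "open ?\<Omega>" by (intro open_Collect_neq continuous_intros)
  obtain e :: "real ^ 'm" where e: "e \<in> Basis" using nonempty_Basis by blast
  \<comment> \<open>The excluded normals have first component 0, so they lie in a hyperplane because
    the first factor has positive dimension.\<close>
  have "- ?\<Omega> \<subseteq> {\<xi>. (e, 0) \<bullet> \<xi> = 0}" by (auto simp: inner_prod_def)
  moreover have "negligible {\<xi> :: (real ^ 'm) \<times> (real ^ 'm). (e, 0) \<bullet> \<xi> = 0}"
    using e nonzero_Basis by (intro negligible_hyperplane) (auto simp: zero_prod_def)
  ultimately show "negligible (- ?\<Omega>)" using negligible_subset by blast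
  show "DIM((real ^ 'm) \<times> (real ^ 'm)) = 2 * CARD('m)" by simp
  show "continuous_on UNIV f" using f unfolding schwartz_radial_def by (blast intro: schwartz_continuous)
  show "norm (x, y) > 1" using xy by (simp add: norm_Pair real_less_rsqrt)
qed

text \<open>A point \<open>(u + s *\<^sub>R y, y)\<close> of the closed unit ball would give
  \<open>norm u \<le> p + s * q\<close> with \<open>p\<^sup>2 + q\<^sup>2 \<le> 1\<close>, hence
  \<open>norm u \<le> sqrt (1 + s\<^sup>2)\<close> by Cauchy-Schwarz in the plane, used here as
  Lagrange's identity.\<close>

lemma exterior_point_on_cone:
  fixes u y :: "'a::real_inner"
  assumes "s \<ge> 0" "norm u > sqrt (1 + s\<^sup>2)"
  shows "(norm (u + s *\<^sub>R y))\<^sup>2 + (norm y)\<^sup>2 > 1"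
proof (rule ccontr)
  define p where "p = norm (u + s *\<^sub>R y)"
  define q where "q = norm y"
  assume "\<not> (norm (u + s *\<^sub>R y))\<^sup>2 + (norm y)\<^sup>2 > 1"
  then have 1: "p\<^sup>2 + q\<^sup>2 \<le> 1" by (simp add: p_def q_def)
  have "norm u \<le> norm (u + s *\<^sub>R y) + norm (s *\<^sub>R y)"
    using norm_triangle_ineq4[of "u + s *\<^sub>R y" "s *\<^sub>R y"] by simp
  then have u: "norm u \<le> p + s * q" using assms by (simp add: p_def q_def)
  have "(p + s * q)\<^sup>2 + (s * p - q)\<^sup>2 = (p\<^sup>2 + q\<^sup>2) * (1 + s\<^sup>2)"
    by (simp add: power2_eq_square algebra_simps)
  then have "(p + s * q)\<^sup>2 \<le> (p\<^sup>2 + q\<^sup>2) * (1 + s\<^sup>2)" using zero_le_power2[of "s * p - q"] by linarith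
  also have "\<dots> \<le> 1 * (1 + s\<^sup>2)" using 1 by (intro mult_right_mono) auto
  finally have "p + s * q \<le> sqrt (1 + s\<^sup>2)" by (simp add: real_le_rsqrt)
  then show False using u assms by linarith
qed

section \<open>Polar coordinates and the reduced transform\<close>

lemma nn_integral_lborel_scale:
  fixes h :: "'a::euclidean_space \<Rightarrow> ennreal"
  assumes [measurable]: "h \<in> borel_measurable borel" and "w > 0"
  shows "(\<integral>\<^sup>+y. h (w *\<^sub>R y) \<partial>lborel) = ennreal (1 / w ^ DIM('a)) * (\<integral>\<^sup>+x. h x \<partial>lborel)"
proof -
  have "(\<integral>\<^sup>+y. h (w *\<^sub>R y) \<partial>lborel)
      = (\<integral>\<^sup>+y. h (w *\<^sub>R y) \<partial>density (distr lborel borel (\<lambda>x. 0 + (1 / w) *\<^sub>R x)) (\<lambda>_. ennreal (\<bar>1 / w\<bar> ^ DIM('a))))"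
    by (subst lborel_affine[of "1 / w" "0::'a"]) (use \<open>w > 0\<close> in simp_all)
  also have "\<dots> = (\<integral>\<^sup>+x. ennreal (\<bar>1 / w\<bar> ^ DIM('a)) * h x \<partial>lborel)"
    using \<open>w > 0\<close> by (simp add: nn_integral_density nn_integral_distr)
  also have "\<dots> = ennreal (1 / w ^ DIM('a)) * (\<integral>\<^sup>+x. h x \<partial>lborel)"
    using \<open>w > 0\<close> by (simp add: nn_integral_cmult power_one_over)
  finally show ?thesis .
qed

lemma sets_unit_sphere_measure [measurable_cong]:
  "sets (unit_sphere_measure :: (real ^ 'm) measure) = sets (restrict_space borel (sphere 0 1))"
  by (simp add: unit_sphere_measure_def)

lemma space_unit_sphere_measure:
  "space (unit_sphere_measure :: (real ^ 'm) measure) = sphere 0 1"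
  using sets_eq_imp_space_eq[OF sets_unit_sphere_measure] by (simp add: space_restrict_space)

lemma sgn_measurable_unit_sphere [measurable]:
  "sgn \<in> restrict_space lborel (cball 0 1 - {0}) \<rightarrow>\<^sub>M restrict_space borel (sphere (0 :: real ^ 'm) 1)"
proof (rule measurable_restrict_space2)
  show "sgn \<in> space (restrict_space lborel (cball 0 1 - {0})) \<rightarrow> sphere (0 :: real ^ 'm) 1"
    by (auto simp: space_restrict_space norm_sgn)
  have "sgn = (\<lambda>x :: real ^ 'm. x /\<^sub>R norm x)" by (simp add: fun_eq_iff sgn_div_norm)
  then have "sgn \<in> borel_measurable (borel :: (real ^ 'm) measure)" by simp
  then have "sgn \<in> borel_measurable (lborel :: (real ^ 'm) measure)" by simp
  then show "sgn \<in> borel_measurable (restrict_space (lborel :: (real ^ 'm) measure) (cball 0 1 - {0}))"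
    by (rule measurable_restrict_space1)
qed

lemma nn_integral_unit_sphere_measure:
  fixes G :: "real ^ 'm \<Rightarrow> ennreal"
  assumes [measurable]: "G \<in> borel_measurable (restrict_space borel (sphere 0 1))"
  shows "(\<integral>\<^sup>+\<theta>. G \<theta> \<partial>unit_sphere_measure) =
    of_nat CARD('m) * (\<integral>\<^sup>+y. G (sgn y) * indicator (cball 0 1 - {0}) y \<partial>lborel)"
proof -
  let ?R = "restrict_space lborel (cball 0 1 - {0 :: real ^ 'm})"
  have "(\<integral>\<^sup>+\<theta>. G \<theta> \<partial>unit_sphere_measure) = of_nat CARD('m) * (\<integral>\<^sup>+\<theta>. G \<theta> \<partial>distr ?R (restrict_space borel (sphere 0 1)) sgn)"
    unfolding unit_sphere_measure_def by (rule nn_integral_scale_measure) simp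
  also have "(\<integral>\<^sup>+\<theta>. G \<theta> \<partial>distr ?R (restrict_space borel (sphere 0 1)) sgn) = (\<integral>\<^sup>+y. G (sgn y) \<partial>?R)"
    by (rule nn_integral_distr) measurable
  also have "\<dots> = (\<integral>\<^sup>+y. G (sgn y) * indicator (cball 0 1 - {0}) y \<partial>lborel)"
    by (rule nn_integral_restrict_space) simp
  finally show ?thesis .
qed

text \<open>The radial integral left over in the polar coordinate formula; its
  \<open>1 / real m\<close> compensates the factor \<open>CARD('m)\<close> in
  \<open>unit_sphere_measure\<close>.\<close>

lemma nn_integral_inverse_power:
  fixes a :: real
  assumes "a > 0" "m > 0"
  shows "(\<integral>\<^sup>+w. ennreal (1 / w ^ Suc m) * indicator {a..} w \<partial>lborel) = ennreal (1 / (real m * a ^ m))"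
proof -
  have "(\<integral>\<^sup>+w. ennreal (1 / w ^ Suc m) * indicator {a..} w \<partial>lborel) = ennreal (0 - (- 1 / (real m * a ^ m)))"
  proof (rule nn_integral_FTC_atLeast[where F="\<lambda>w. - 1 / (real m * w ^ m)"])
    fix w assume w: "a \<le> w"
    obtain k where k: "m = Suc k" using \<open>m > 0\<close> gr0_implies_Suc by blast
    have "w > 0" using w assms by simp
    then have "((\<lambda>w. - 1 / (real m * w ^ m)) has_real_derivative
        (0 * (real m * w ^ m) - (- 1) * (real m * (real m * w ^ (m - 1)))) / ((real m * w ^ m) * (real m * w ^ m))) (at w)"
      using assms by (intro DERIV_divide DERIV_const DERIV_cmult DERIV_pow[of m w, simplified]) auto
    moreover have "(0 * (real m * w ^ m) - (- 1) * (real m * (real m * w ^ (m - 1)))) / ((real m * w ^ m) * (real m * w ^ m)) = 1 / w ^ Suc m"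
      using \<open>w > 0\<close> assms by (simp add: k field_simps del: of_nat_Suc)
    ultimately show "((\<lambda>w. - 1 / (real m * w ^ m)) has_real_derivative 1 / w ^ Suc m) (at w)" by simp
    show "0 \<le> 1 / w ^ Suc m" using \<open>w > 0\<close> by simp
  next
    have "((\<lambda>w. - 1 / real m * inverse (w ^ m)) \<longlongrightarrow> - 1 / real m * 0) at_top"
      by (intro tendsto_mult tendsto_const tendsto_inverse_0_at_top filterlim_pow_at_top filterlim_ident assms)
    then show "((\<lambda>w. - 1 / (real m * w ^ m)) \<longlongrightarrow> 0) at_top"
      by (simp add: field_simps)
  qed simp
  then show ?thesis by simp
qed

text \<open>Substituting \<open>z = w |y|\<close> in the radial integral and then \<open>x = w y\<close> in the ball integral
  that defines the surface measure, only scaling of Lebesgue measure is needed.\<close>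
lemma nn_integral_polar:
  fixes F :: "real ^ 'm \<Rightarrow> ennreal"
  assumes [measurable]: "F \<in> borel_measurable borel"
  shows "(\<integral>\<^sup>+\<theta>. (\<integral>\<^sup>+z. ennreal (indicator {0<..} z * z ^ (CARD('m) - 1)) * F (z *\<^sub>R \<theta>) \<partial>lborel) \<partial>unit_sphere_measure)
      = (\<integral>\<^sup>+x. F x \<partial>lborel)"
proof -
  define m where "m = CARD('m)"
  have m: "m > 0" by (simp add: m_def)
  define B :: "(real ^ 'm) set" where "B = cball 0 1"
  have [measurable]: "B \<in> sets borel" by (simp add: B_def)
  define G where "G \<theta> = (\<integral>\<^sup>+z. ennreal (indicator {0<..} z * z ^ (m - 1)) * F (z *\<^sub>R \<theta>) \<partial>lborel)" for \<theta> :: "real ^ 'm"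
  have Gm: "G \<in> borel_measurable borel"
    unfolding G_def [abs_def] by measurable
  \<comment> \<open>After \<open>z = norm y * w\<close> the point \<open>z *\<^sub>R sgn y\<close>
    is \<open>w *\<^sub>R y\<close>, and the radial density becomes
    \<open>norm y ^ m * w ^ (m - 1)\<close>. At \<open>y = 0\<close> both sides vanish because
    \<open>m > 0\<close>.\<close>
  have inner: "G (sgn y) * indicator (cball 0 1 - {0}) y
      = (\<integral>\<^sup>+w. ennreal (indicator {0<..} w * w ^ (m - 1)) * (indicator B y * ennreal (norm y ^ m) * F (w *\<^sub>R y)) \<partial>lborel)" for y
  proof (cases "y = 0")
    case True
    then show ?thesis by (simp add: zero_power[OF m])
  next
    case False
    define r where "r = norm y"
    have r: "r > 0" using False by (simp add: r_def)
    have "G (sgn y) = ennreal r * (\<integral>\<^sup>+w. ennreal (indicator {0<..} (r * w) * (r * w) ^ (m - 1)) * F ((r * w) *\<^sub>R sgn y) \<partial>lborel)"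
      unfolding G_def
      using nn_integral_real_affine[of "\<lambda>z. ennreal (indicator {0<..} z * z ^ (m - 1)) * F (z *\<^sub>R sgn y)" r 0] r by simp
    also have "\<dots> = (\<integral>\<^sup>+w. ennreal r * (ennreal (indicator {0<..} (r * w) * (r * w) ^ (m - 1)) * F ((r * w) *\<^sub>R sgn y)) \<partial>lborel)"
      by (rule nn_integral_cmult[symmetric]) measurable
    also have "\<dots> = (\<integral>\<^sup>+w. ennreal (indicator {0<..} w * w ^ (m - 1)) * (ennreal (norm y ^ m) * F (w *\<^sub>R y)) \<partial>lborel)"
    proof (rule nn_integral_cong)
      fix w :: real
      have eq: "(r * w) *\<^sub>R sgn y = w *\<^sub>R y" using r by (simp add: sgn_div_norm r_def)
      have "r * (r * w) ^ (m - 1) = w ^ (m - 1) * r ^ m"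
        using m by (cases m) (simp_all add: power_mult_distrib)
      then have "ennreal r * ennreal (indicator {0<..} (r * w) * (r * w) ^ (m - 1)) = ennreal (indicator {0<..} w * w ^ (m - 1)) * ennreal (r ^ m)"
        using r by (cases "w > 0") (simp_all add: ennreal_mult[symmetric] zero_less_mult_iff)
      then show "ennreal r * (ennreal (indicator {0<..} (r * w) * (r * w) ^ (m - 1)) * F ((r * w) *\<^sub>R sgn y))
         = ennreal (indicator {0<..} w * w ^ (m - 1)) * (ennreal (norm y ^ m) * F (w *\<^sub>R y))"
        unfolding eq r_def[symmetric] by (simp only: mult.assoc[symmetric])
    qed
    finally show ?thesis using False by (cases "norm y \<le> 1") (simp_all add: B_def)
  qed
  have "(\<integral>\<^sup>+\<theta>. G \<theta> \<partial>unit_sphere_measure) = of_nat m * (\<integral>\<^sup>+y. G (sgn y) * indicator (cball 0 1 - {0}) y \<partial>lborel)"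
    unfolding m_def by (rule nn_integral_unit_sphere_measure) (rule measurable_restrict_space1[OF Gm])
  also have "(\<integral>\<^sup>+y. G (sgn y) * indicator (cball 0 1 - {0}) y \<partial>lborel)
     = (\<integral>\<^sup>+y. (\<integral>\<^sup>+w. ennreal (indicator {0<..} w * w ^ (m - 1)) * (indicator B y * ennreal (norm y ^ m) * F (w *\<^sub>R y)) \<partial>lborel) \<partial>lborel)"
    by (simp only: inner)
  also have "\<dots> = (\<integral>\<^sup>+w. (\<integral>\<^sup>+y. ennreal (indicator {0<..} w * w ^ (m - 1)) * (indicator B y * ennreal (norm y ^ m) * F (w *\<^sub>R y)) \<partial>lborel) \<partial>lborel)"
    by (rule lborel_pair.Fubini') measurable
  also have "\<dots> = (\<integral>\<^sup>+w. (\<integral>\<^sup>+x. (ennreal (norm x ^ m) * F x) * (ennreal (1 / w ^ Suc m) * indicator {norm x..} w * indicator {0<..} w) \<partial>lborel) \<partial>lborel)"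
  proof (rule nn_integral_cong)
    fix w :: real
    show "(\<integral>\<^sup>+y. ennreal (indicator {0<..} w * w ^ (m - 1)) * (indicator B y * ennreal (norm y ^ m) * F (w *\<^sub>R y)) \<partial>lborel)
       = (\<integral>\<^sup>+x. (ennreal (norm x ^ m) * F x) * (ennreal (1 / w ^ Suc m) * indicator {norm x..} w * indicator {0<..} w) \<partial>lborel)"
    proof (cases "w > 0")
      case True
      \<comment> \<open>The integrand in terms of \<open>x = w *\<^sub>R y\<close>: the condition
        \<open>norm y \<le> 1\<close> becomes \<open>norm x \<le> w\<close>, which is later read as
        a lower bound for \<open>w\<close>. Together with the Jacobian the powers of
        \<open>w\<close> collect to \<open>1 / w ^ Suc m\<close>.\<close>
      define h where "h x = indicator {0..w} (norm x) * ennreal (norm x ^ m / w ^ m) * F x" for x :: "real ^ 'm"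
      have [measurable]: "h \<in> borel_measurable borel" unfolding h_def [abs_def] by measurable
      have "indicator B y * ennreal (norm y ^ m) * F (w *\<^sub>R y) = h (w *\<^sub>R y)" for y
        using True by (simp add: h_def B_def power_mult_distrib indicator_def mult_le_cancel_left1)
      then have "(\<integral>\<^sup>+y. ennreal (indicator {0<..} w * w ^ (m - 1)) * (indicator B y * ennreal (norm y ^ m) * F (w *\<^sub>R y)) \<partial>lborel)
         = ennreal (w ^ (m - 1)) * (\<integral>\<^sup>+y. h (w *\<^sub>R y) \<partial>lborel)"
        using True by (simp add: nn_integral_cmult)
      also have "\<dots> = (ennreal (w ^ (m - 1)) * ennreal (1 / w ^ m)) * (\<integral>\<^sup>+x. h x \<partial>lborel)"
        using True by (simp add: nn_integral_lborel_scale m_def mult.assoc)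
      also have "\<dots> = (\<integral>\<^sup>+x. (ennreal (w ^ (m - 1)) * ennreal (1 / w ^ m)) * h x \<partial>lborel)"
        by (rule nn_integral_cmult[symmetric]) measurable
      also have "\<dots> = (\<integral>\<^sup>+x. (ennreal (norm x ^ m) * F x) * (ennreal (1 / w ^ Suc m) * indicator {norm x..} w * indicator {0<..} w) \<partial>lborel)"
      proof (rule nn_integral_cong)
        fix x :: "real ^ 'm"
        have "w ^ (m - 1) * (1 / w ^ m) * (norm x ^ m / w ^ m) = norm x ^ m * (1 / w ^ Suc m)"
          using True m by (cases m) (simp_all add: field_simps)
        then have "(ennreal (w ^ (m - 1)) * ennreal (1 / w ^ m)) * ennreal (norm x ^ m / w ^ m) = ennreal (norm x ^ m) * ennreal (1 / w ^ Suc m)"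
          using True by (simp only: ennreal_mult[symmetric] mult_nonneg_nonneg zero_le_power divide_nonneg_nonneg less_imp_le norm_ge_zero zero_le_one)
        then have "(ennreal (w ^ (m - 1)) * ennreal (1 / w ^ m)) * (ennreal (norm x ^ m / w ^ m) * F x) = (ennreal (norm x ^ m) * F x) * ennreal (1 / w ^ Suc m)"
          by (metis mult.assoc mult.commute)
        then show "(ennreal (w ^ (m - 1)) * ennreal (1 / w ^ m)) * h x = (ennreal (norm x ^ m) * F x) * (ennreal (1 / w ^ Suc m) * indicator {norm x..} w * indicator {0<..} w)"
          using True by (cases "norm x \<le> w") (simp_all only: h_def indicator_simps greaterThan_iff atLeast_iff atLeastAtMost_iff norm_ge_zero simp_thms mult_1_left mult_1_right mult_zero_left mult_zero_right)
      qed
      finally show ?thesis .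
    qed simp
  qed
  also have "\<dots> = (\<integral>\<^sup>+x. (\<integral>\<^sup>+w. (ennreal (norm x ^ m) * F x) * (ennreal (1 / w ^ Suc m) * indicator {norm x..} w * indicator {0<..} w) \<partial>lborel) \<partial>lborel)"
  proof (rule lborel_pair.Fubini')
    have "(\<lambda>p. (ennreal (norm (fst p) ^ m) * F (fst p)) * (ennreal (1 / snd p ^ Suc m) * indicator {p. norm (fst p) \<le> snd p} p * indicator {0<..} (snd p)))
       \<in> borel_measurable (borel \<Otimes>\<^sub>M borel)"
      by (measurable; simp)
    then show "(\<lambda>(x, w). (ennreal (norm x ^ m) * F x) * (ennreal (1 / w ^ Suc m) * indicator {norm x..} w * indicator {0<..} w))
       \<in> borel_measurable (lborel \<Otimes>\<^sub>M lborel)"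
      by (simp add: case_prod_beta indicator_def)
  qed
  also have "\<dots> = (\<integral>\<^sup>+x. F x * ennreal (1 / real m) \<partial>lborel)"
  proof (rule nn_integral_cong_AE)
    show "AE x in lborel. (\<integral>\<^sup>+w. (ennreal (norm x ^ m) * F x) * (ennreal (1 / w ^ Suc m) * indicator {norm x..} w * indicator {0<..} w) \<partial>lborel) = F x * ennreal (1 / real m)"
      using AE_lborel_singleton[of "0 :: real ^ 'm"]
    proof eventually_elim
      case (elim x)
      then have x: "norm x > 0" by simp
      have "(\<integral>\<^sup>+w. (ennreal (norm x ^ m) * F x) * (ennreal (1 / w ^ Suc m) * indicator {norm x..} w * indicator {0<..} w) \<partial>lborel)
        = (\<integral>\<^sup>+w. (ennreal (norm x ^ m) * F x) * (ennreal (1 / w ^ Suc m) * indicator {norm x..} w) \<partial>lborel)"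
        by (intro nn_integral_cong) (auto simp: indicator_def dest: less_le_trans[OF x])
      also have "\<dots> = (ennreal (norm x ^ m) * F x) * ennreal (1 / (real m * norm x ^ m))"
        by (subst nn_integral_cmult, measurable) (simp only: nn_integral_inverse_power[OF x m])
      also have "\<dots> = F x * (ennreal (norm x ^ m) * ennreal (1 / (real m * norm x ^ m)))"
        by (simp only: mult_ac)
      also have "ennreal (norm x ^ m) * ennreal (1 / (real m * norm x ^ m)) = ennreal (1 / real m)"
        using x m by (simp add: ennreal_mult[symmetric])
      finally show ?case .
    qed
  qed
  also have "\<dots> = (\<integral>\<^sup>+x. F x \<partial>lborel) * ennreal (1 / real m)"
    by (rule nn_integral_multc) measurable
  finally have "(\<integral>\<^sup>+\<theta>. G \<theta> \<partial>unit_sphere_measure) = (\<integral>\<^sup>+x. F x \<partial>lborel) * (ennreal (real m) * ennreal (1 / real m))"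
    by (simp only: ennreal_of_nat_eq_real_of_nat mult_ac)
  also have "ennreal (real m) * ennreal (1 / real m) = 1"
    using m by (simp add: ennreal_mult[symmetric])
  finally show ?thesis by (simp add: G_def m_def)
qed

text \<open>The nonnegative formula, applied to indicators, says that
  \<open>(\<theta>, z) \<mapsto> z *\<^sub>R \<theta>\<close> pushes the product of surface measure
  and radial density forward to Lebesgue measure. Complex integrals then follow by transport and
  Fubini, for which finiteness of the surface measure is established first.\<close>

lemma integral_polar:
  fixes F :: "real ^ 'm \<Rightarrow> complex"
  assumes F: "integrable lborel F"
  shows "(LINT x|lborel. F x) =
    (LINT \<theta>|unit_sphere_measure. (LINT z|lborel. (indicator {0<..} z * z ^ (CARD('m) - 1)) *\<^sub>R F (z *\<^sub>R \<theta>)))"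
proof -
  have [measurable]: "F \<in> borel_measurable borel" using F by (simp add: borel_measurable_integrable)
  define d where "d z = indicator {0<..} z * z ^ (CARD('m) - 1)" for z :: real
  have [measurable]: "d \<in> borel_measurable borel" unfolding d_def [abs_def] by measurable
  have d0: "d z \<ge> 0" for z by (simp add: d_def indicator_def)
  define M2 where "M2 = density lborel (\<lambda>z. ennreal (d z))"
  have [measurable_cong]: "sets M2 = sets borel" by (simp add: M2_def)
  have "sigma_finite_measure M2"
    unfolding M2_def by (subst sigma_finite_measure.sigma_finite_iff_density_finite[OF sigma_finite_lborel]) auto
  then interpret M2: sigma_finite_measure M2 .
  let ?S = "unit_sphere_measure :: (real ^ 'm) measure"
  have id [measurable]: "(\<lambda>\<theta>. \<theta>) \<in> ?S \<rightarrow>\<^sub>M borel"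
    by (subst measurable_cong_sets[OF sets_unit_sphere_measure refl]) (rule measurable_restrict_space1, simp)
  have "emeasure ?S (space ?S) < \<infinity>"
  proof -
    have "emeasure ?S (space ?S) = (\<integral>\<^sup>+\<theta>. 1 \<partial>?S)" by simp
    also have "\<dots> = of_nat CARD('m) * (\<integral>\<^sup>+y. 1 * indicator (cball 0 1 - {0 :: real ^ 'm}) y \<partial>lborel)"
      by (rule nn_integral_unit_sphere_measure) simp
    also have "(\<integral>\<^sup>+y. 1 * indicator (cball 0 1 - {0 :: real ^ 'm}) y \<partial>lborel) = emeasure lborel (cball 0 1 - {0 :: real ^ 'm})"
      by simp
    finally have "emeasure ?S (space ?S) = of_nat CARD('m) * emeasure lborel (cball 0 1 - {0 :: real ^ 'm})" .
    moreover have "emeasure lborel (cball 0 1 - {0 :: real ^ 'm}) < \<infinity>"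
      by (rule emeasure_bounded_finite) (auto intro: bounded_subset[OF bounded_cball])
    ultimately show ?thesis by (simp add: ennreal_mult_less_top of_nat_less_top)
  qed
  then interpret S: finite_measure ?S by (intro finite_measureI) auto
  interpret P: pair_sigma_finite ?S M2 ..
  let ?T = "\<lambda>p :: (real ^ 'm) \<times> real. snd p *\<^sub>R fst p"
  have T: "?T \<in> ?S \<Otimes>\<^sub>M M2 \<rightarrow>\<^sub>M borel"
    using id by measurable
  have "distr (?S \<Otimes>\<^sub>M M2) borel ?T = lborel"
  proof (rule measure_eqI)
    fix E assume "E \<in> sets (distr (?S \<Otimes>\<^sub>M M2) borel ?T)"
    then have [measurable]: "E \<in> sets borel" by simp
    have "emeasure (distr (?S \<Otimes>\<^sub>M M2) borel ?T) E = (\<integral>\<^sup>+x. indicator E x \<partial>distr (?S \<Otimes>\<^sub>M M2) borel ?T)"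
      by simp
    also have "\<dots> = (\<integral>\<^sup>+p. indicator E (?T p) \<partial>(?S \<Otimes>\<^sub>M M2))"
      by (rule nn_integral_distr[OF T]) simp
    also have "\<dots> = (\<integral>\<^sup>+\<theta>. (\<integral>\<^sup>+z. indicator E (z *\<^sub>R \<theta>) \<partial>M2) \<partial>?S)"
      by (subst M2.nn_integral_fst[symmetric]) (simp_all add: measurable_compose[OF T])
    also have "\<dots> = (\<integral>\<^sup>+\<theta>. (\<integral>\<^sup>+z. ennreal (d z) * indicator E (z *\<^sub>R \<theta>) \<partial>lborel) \<partial>?S)"
      unfolding M2_def by (intro nn_integral_cong nn_integral_density) measurable
    also have "\<dots> = (\<integral>\<^sup>+x. indicator E x \<partial>lborel)"
      unfolding d_def by (rule nn_integral_polar) measurable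
    also have "\<dots> = emeasure lborel E" by simp
    finally show "emeasure (distr (?S \<Otimes>\<^sub>M M2) borel ?T) E = emeasure lborel E" .
  qed simp
  note distr = this
  have "(LINT x|lborel. F x) = (LINT p|(?S \<Otimes>\<^sub>M M2). F (?T p))"
    by (subst distr[symmetric], rule integral_distr[OF T]) measurable
  also have "\<dots> = (LINT \<theta>|?S. (LINT z|M2. F (z *\<^sub>R \<theta>)))"
  proof -
    have "integrable (?S \<Otimes>\<^sub>M M2) (\<lambda>p. F (?T p))"
      using F by (subst (asm) distr[symmetric], subst (asm) integrable_distr_eq[OF T]) auto
    from P.integral_fst'[OF this] show ?thesis by simp
  qed
  also have "\<dots> = (LINT \<theta>|?S. (LINT z|lborel. d z *\<^sub>R F (z *\<^sub>R \<theta>)))"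
    unfolding M2_def by (intro Bochner_Integration.integral_cong[OF refl] integral_density) (use d0 in auto)
  finally show ?thesis unfolding d_def .
qed

section \<open>One-dimensional base space, and equality of the two transforms\<close>

lemma lborel_distr_vec:
  assumes "CARD('m) = 1"
  shows "distr lborel borel vec = (lborel :: (real ^ 'm) measure)"
proof (rule lborel_eqI[symmetric])
  obtain i :: 'm where i: "UNIV = {i}" using assms by (auto simp: card_1_singleton_iff)
  have vm [measurable]: "(vec :: real \<Rightarrow> real ^ 'm) \<in> borel_measurable borel"
    unfolding vec_def by (intro borel_measurable_continuous_onI continuous_intros)
  have "j = i" for j using i by (metis UNIV_I singletonD)
  then have B: "Basis = {axis i (1 :: real)}" by (auto simp: Basis_vec_def, metis)
  fix l u :: "real ^ 'm" assume le: "\<And>b. b \<in> Basis \<Longrightarrow> l \<bullet> b \<le> u \<bullet> b"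
  have "vec -` box l u = box (l $ i) (u $ i)"
    by (auto simp: mem_box B inner_axis)
  then show "emeasure (distr lborel borel vec) (box l u) = (\<Prod>b\<in>Basis. (u - l) \<bullet> b)"
    using le by (simp add: emeasure_distr B inner_axis)
qed simp

lemma norm_vec_card_1:
  assumes "CARD('m) = 1"
  shows "norm (vec t :: real ^ 'm) = \<bar>t\<bar>"
  using assms by (simp add: norm_vec_def L2_set_def)

text \<open>Polar coordinates \<open>y = z *\<^sub>R \<theta>\<close> with
  \<open>norm y = z\<close>. For \<open>CARD('m) = 1\<close> the sphere consists of two points, and
  the formula amounts to folding the line at 0.\<close>

lemma reduced_cone_transform_eq:
  fixes f :: "(real ^ 'm) \<times> (real ^ 'm) \<Rightarrow> complex"
  assumes f: "f \<in> schwartz_radial" and g: "\<And>x y. g (x, norm y) = f (x, y)"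
  shows "reduced_cone_transform g u (norm v) = cone_transform f u v"
proof -
  define s where "s = norm v"
  have schw: "schwartz f" using f unfolding schwartz_radial_def by blast
  define F where "F y = f (u + s *\<^sub>R y, y)" for y
  have F: "integrable lborel F" unfolding F_def [abs_def] by (rule schwartz_slice_integrable[OF schw])
  then have [measurable]: "F \<in> borel_measurable borel" by (simp add: borel_measurable_integrable)
  have cone: "cone_transform f u v = (LINT y|lborel. F y)" by (simp add: cone_transform_def F_def s_def)
  have pos: "AE z in lborel. z \<noteq> (0 :: real)" by (rule AE_lborel_singleton)
  show ?thesis
  proof (cases "CARD('m) = 1")
    case False
    have "(LINT y|lborel. F y) = (LINT \<theta>|unit_sphere_measure. (LINT z|lborel. (indicator {0<..} z * z ^ (CARD('m) - 1)) *\<^sub>R F (z *\<^sub>R \<theta>)))"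
      by (rule integral_polar[OF F])
    also have "\<dots> = (LINT \<theta>|unit_sphere_measure. (LINT z:{0..}|lborel. z ^ (CARD('m) - 1) *\<^sub>R g (u + (z * s) *\<^sub>R \<theta>, z)))"
    proof (rule Bochner_Integration.integral_cong[OF refl])
      fix \<theta> :: "real ^ 'm" assume "\<theta> \<in> space unit_sphere_measure"
      then have \<theta>: "norm \<theta> = 1" by (simp add: space_unit_sphere_measure)
      have eq: "F (z *\<^sub>R \<theta>) = g (u + (z * s) *\<^sub>R \<theta>, z)" if "z \<ge> 0" for z
        using g[of "u + (z * s) *\<^sub>R \<theta>" "z *\<^sub>R \<theta>"] \<theta> that by (simp add: F_def mult.commute)
      \<comment> \<open>\<open>g\<close> is tied to \<open>f\<close> only at nonnegative second
        arguments, so it is replaced by the measurable \<open>F\<close> under the indicator, before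
        the endpoint 0 is adjusted almost everywhere.\<close>
      have eq1: "indicator {0..} z *\<^sub>R (z ^ (CARD('m) - 1) *\<^sub>R g (u + (z * s) *\<^sub>R \<theta>, z))
          = indicator {0..} z *\<^sub>R (z ^ (CARD('m) - 1) *\<^sub>R F (z *\<^sub>R \<theta>))" for z
        using eq[of z] by (cases "z \<ge> 0") simp_all
      show "(LINT z|lborel. (indicator {0<..} z * z ^ (CARD('m) - 1)) *\<^sub>R F (z *\<^sub>R \<theta>))
          = (LINT z:{0..}|lborel. z ^ (CARD('m) - 1) *\<^sub>R g (u + (z * s) *\<^sub>R \<theta>, z))"
        unfolding set_lebesgue_integral_def eq1
      proof (rule integral_cong_AE)
        show "AE z in lborel. (indicator {0<..} z * z ^ (CARD('m) - 1)) *\<^sub>R F (z *\<^sub>R \<theta>)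
           = indicator {0..} z *\<^sub>R (z ^ (CARD('m) - 1) *\<^sub>R F (z *\<^sub>R \<theta>))"
          using pos by eventually_elim (auto simp: indicator_def)
      qed measurable
    qed
    finally show ?thesis using False by (simp add: reduced_cone_transform_def cone s_def)
  next
    case True
    have vm [measurable]: "(vec :: real \<Rightarrow> real ^ 'm) \<in> borel_measurable borel"
      unfolding vec_def by (intro borel_measurable_continuous_onI continuous_intros)
    define H where "H t = F (vec t)" for t
    have Hm [measurable]: "H \<in> borel_measurable borel" unfolding H_def [abs_def] by measurable
    have H: "integrable lborel H"
      using F lborel_distr_vec[OF True, symmetric] integrable_distr_eq[of vec lborel borel F] by (simp add: H_def [abs_def])
    have eqF: "(LINT y|lborel. F y) = (LINT t|lborel. H t)"
      by (subst lborel_distr_vec[OF True, symmetric], subst integral_distr) (auto simp: H_def [abs_def])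
    have nv: "norm (vec t :: real ^ 'm) = \<bar>t\<bar>" for t by (rule norm_vec_card_1[OF True])
    have eq: "g (u + vec (z * s), z) + g (u - vec (z * s), z) = H z + H (- z)" if "z \<ge> 0" for z
    proof -
      have "vec (z * s) = s *\<^sub>R (vec z :: real ^ 'm)" "s *\<^sub>R (vec (- z) :: real ^ 'm) = - vec (z * s)"
        by (simp_all add: vec_eq_iff)
      then show ?thesis
        using g[of "u + vec (z * s)" "vec z"] g[of "u - vec (z * s)" "vec (- z)"] that
        by (simp add: nv H_def F_def)
    qed
    have eq1: "indicator {0..} z *\<^sub>R (g (u + vec (z * s), z) + g (u - vec (z * s), z))
       = indicator {0..} z *\<^sub>R (H z + H (- z))" for z
      using eq[of z] by (cases "z \<ge> 0") simp_all
    have Hneg: "integrable lborel (\<lambda>t. H (- t))"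
      using lborel_integrable_real_affine[OF H, of "-1" 0] by simp
    have i1: "integrable lborel (\<lambda>t. indicator {0..} t *\<^sub>R H t)" "integrable lborel (\<lambda>t. indicator {0..} t *\<^sub>R H (- t))"
      "integrable lborel (\<lambda>t. indicator {..<0} t *\<^sub>R H t)"
      using H Hneg by (intro integrable_mult_indicator; simp)+
    have "(LINT t|lborel. H t) = (LINT t|lborel. indicator {0..} t *\<^sub>R H t + indicator {..<0} t *\<^sub>R H t)"
      by (intro Bochner_Integration.integral_cong) (auto simp: indicator_def)
    also have "\<dots> = (LINT t|lborel. indicator {0..} t *\<^sub>R H t) + (LINT t|lborel. indicator {..<0} t *\<^sub>R H t)"
      using i1 by simp
    \<comment> \<open>The negative half line is reflected; it supplies the term with
      \<open>u - vec (z * s)\<close>.\<close>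
    also have "(LINT t|lborel. indicator {..<0} t *\<^sub>R H t) = (LINT t|lborel. indicator {..<0} (- t) *\<^sub>R H (- t))"
      using lborel_integral_real_affine[of "-1" "\<lambda>t. indicator {..<0} t *\<^sub>R H t" 0] by simp
    also have "\<dots> = (LINT t|lborel. indicator {0..} t *\<^sub>R H (- t))"
    proof (rule integral_cong_AE)
      show "AE t in lborel. indicator {..<0} (- t) *\<^sub>R H (- t) = indicator {0..} t *\<^sub>R H (- t)"
        using pos by eventually_elim (auto simp: indicator_def)
    qed measurable
    finally have "(LINT t|lborel. H t) = (LINT t|lborel. indicator {0..} t *\<^sub>R (H t + H (- t)))"
      using i1 by (simp add: scaleR_add_right)
    then show ?thesis
      using True by (simp add: reduced_cone_transform_def cone eqF s_def[symmetric] set_lebesgue_integral_def eq1)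
  qed
qed

lemma cone_transform_eq_0:
  fixes f :: "(real ^ 'm) \<times> (real ^ 'm) \<Rightarrow> complex"
  assumes "\<And>x y. (norm x)\<^sup>2 + (norm y)\<^sup>2 > 1 \<Longrightarrow> f (x, y) = 0" "norm u > sqrt (1 + (norm v)\<^sup>2)"
  shows "cone_transform f u v = 0"
  using assms exterior_point_on_cone[of "norm v" u] by (simp add: cone_transform_def)

theorem theorem7:
  fixes n :: nat and f :: "(real ^ 'm) \<times> (real ^ 'm) \<Rightarrow> complex"
  assumes "n \<ge> 2" and "CARD('m) = n - 1" and "f \<in> schwartz_radial"
  shows "((\<forall>u v. norm u > sqrt (1 + (norm v)\<^sup>2) \<longrightarrow> cone_transform f u v = 0) \<longleftrightarrow>
          (\<forall>x y. (norm x)\<^sup>2 + (norm y)\<^sup>2 > 1 \<longrightarrow> f (x, y) = 0)) \<and>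
         (\<forall>g :: (real ^ 'm) \<times> real \<Rightarrow> complex.
            (\<forall>x y. g (x, norm y) = f (x, y)) \<longrightarrow>
            ((\<forall>u s. s \<ge> 0 \<longrightarrow> norm u > sqrt (1 + s\<^sup>2) \<longrightarrow> reduced_cone_transform g u s = 0) \<longleftrightarrow>
             (\<forall>x z. z \<ge> 0 \<longrightarrow> (norm x)\<^sup>2 + z\<^sup>2 > 1 \<longrightarrow> g (x, z) = 0)))"
proof -
  have main: "(\<forall>u v. norm u > sqrt (1 + (norm v)\<^sup>2) \<longrightarrow> cone_transform f u v = 0) \<longleftrightarrow>
          (\<forall>x y. (norm x)\<^sup>2 + (norm y)\<^sup>2 > 1 \<longrightarrow> f (x, y) = 0)"
    using cone_transform_support[OF assms(3)] cone_transform_eq_0[of f] by blast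
  have "(\<forall>u s. s \<ge> 0 \<longrightarrow> norm u > sqrt (1 + s\<^sup>2) \<longrightarrow> reduced_cone_transform g u s = 0) \<longleftrightarrow>
             (\<forall>x z. z \<ge> 0 \<longrightarrow> (norm x)\<^sup>2 + z\<^sup>2 > 1 \<longrightarrow> g (x, z) = 0)"
    if g: "\<forall>x y. g (x, norm y) = f (x, y)" for g :: "(real ^ 'm) \<times> real \<Rightarrow> complex"
  proof -
    \<comment> \<open>The dimension is positive, so every \<open>s \<ge> 0\<close> is the norm of
      some vector. This converts quantifiers over radii into quantifiers over vectors on both sides
      of the equivalence.\<close>
    have radius: "(\<forall>s\<ge>0. P s) \<longleftrightarrow> (\<forall>v :: real ^ 'm. P (norm v))" for P :: "real \<Rightarrow> bool"
      by (metis norm_ge_zero vector_choose_size)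
    have "(\<forall>u s. s \<ge> 0 \<longrightarrow> norm u > sqrt (1 + s\<^sup>2) \<longrightarrow> reduced_cone_transform g u s = 0) \<longleftrightarrow>
        (\<forall>u v. norm u > sqrt (1 + (norm v)\<^sup>2) \<longrightarrow> cone_transform f u v = 0)"
      by (simp only: radius reduced_cone_transform_eq[OF assms(3) g[rule_format]])
    also note main
    also have "(\<forall>x y. (norm x)\<^sup>2 + (norm y)\<^sup>2 > 1 \<longrightarrow> f (x, y) = 0) \<longleftrightarrow>
        (\<forall>x z. z \<ge> 0 \<longrightarrow> (norm x)\<^sup>2 + z\<^sup>2 > 1 \<longrightarrow> g (x, z) = 0)"
      by (simp only: radius g[rule_format])
    finally show ?thesis .
  qed
  with main show ?thesis by blast
qed

end
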